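(* For every $N\in\mathbb N$ there exists $\lambda_N\ge 2$ such that for every integer $\lambda\ge\lambda_N$ the following holds. Let $\mathbf w=(w_k)_{k\in\mathbb Z}$ be given by $w_{\lambda^j}=w_{-\lambda^j}=2^{-j}$ for all integers $j\ge 0$, and $w_k=0$ for all other $k\in\mathbb Z$. Then $$\|e^{-itH_{\mathbf w}}\|_{\ell^1(\mathbb Z)\to\ell^\infty(\mathbb Z)}\lesssim_N |t|^{-N},\qquad |t|\to\infty,$$ i.e. the left-hand side is at most $C_N|t|^{-N}$ for all sufficiently large $|t|$, where $C_N$ depends only on $N$.
   Context: For $\mathbf w=(w_k)_{k\in\mathbb Z}\in\ell^1(\mathbb Z)$ with $w_{-k}=w_k$ and $w_k\ge0$, $H_{\mathbf w}$ denotes the bounded self-adjoint operator on $\ell^2(\mathbb Z)$ given by $(H_{\mathbf w}u)(n)=\sum_{k\in\mathbb Z}w_k\,u(n+k)$. For a bounded operator $A$ on $\ell^2(\mathbb Z)$, $\|A\|_{\ell^1\to\ell^\infty}=\sup_{n,m\in\mathbb Z}|\langle\delta_n,A\delta_m\rangle|$. *)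

theory Defs
  imports "HOL-Analysis.Analysis"
begin

section \<open>The Hilbert space of square-summable families\<close>

definition square_summable :: "('a \<Rightarrow> complex) \<Rightarrow> bool" where
  "square_summable f \<longleftrightarrow> (\<lambda>i. (cmod (f i))\<^sup>2) summable_on UNIV"

lemma square_summable_iff:
  "square_summable f \<longleftrightarrow> (\<exists>B. \<forall>F. finite F \<longrightarrow> L2_set (\<lambda>i. cmod (f i)) F \<le> B)"
proof
  assume *: "square_summable f"
  show "\<exists>B. \<forall>F. finite F \<longrightarrow> L2_set (\<lambda>i. cmod (f i)) F \<le> B"
  proof (intro exI allI impI)
    fix F :: "'a set"
    assume "finite F"
    then show "L2_set (\<lambda>i. cmod (f i)) F \<le> sqrt (\<Sum>\<^sub>\<infinity>i. (cmod (f i))\<^sup>2)"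
      using * unfolding L2_set_def square_summable_def
      by (intro real_sqrt_le_mono finite_sum_le_infsum) auto
  qed
next
  assume "\<exists>B. \<forall>F. finite F \<longrightarrow> L2_set (\<lambda>i. cmod (f i)) F \<le> B"
  then obtain B where B: "L2_set (\<lambda>i. cmod (f i)) F \<le> B" if "finite F" for F
    by blast
  have "(\<Sum>i\<in>F. (cmod (f i))\<^sup>2) \<le> B\<^sup>2" if "finite F" for F
    using B[OF that] unfolding L2_set_def by (rule sqrt_le_D)
  then show "square_summable f"
    unfolding square_summable_def
    by (intro nonneg_bdd_above_summable_on bdd_aboveI[where M = "B\<^sup>2"]) auto
qed

lemma square_summable_0: "square_summable (\<lambda>_. 0)"
  by (simp add: square_summable_def)

lemma square_summable_add:
  assumes "square_summable f" "square_summable g"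
  shows "square_summable (\<lambda>i. f i + g i)"
proof -
  obtain A B where A: "\<And>F. finite F \<Longrightarrow> L2_set (\<lambda>i. cmod (f i)) F \<le> A"
    and B: "\<And>F. finite F \<Longrightarrow> L2_set (\<lambda>i. cmod (g i)) F \<le> B"
    using assms unfolding square_summable_iff by blast
  have "L2_set (\<lambda>i. cmod (f i + g i)) F \<le> A + B" if "finite F" for F
  proof -
    have "L2_set (\<lambda>i. cmod (f i + g i)) F \<le> L2_set (\<lambda>i. cmod (f i) + cmod (g i)) F"
      by (intro L2_set_mono norm_triangle_ineq) auto
    also have "\<dots> \<le> L2_set (\<lambda>i. cmod (f i)) F + L2_set (\<lambda>i. cmod (g i)) F"
      by (rule L2_set_triangle_ineq)
    also have "\<dots> \<le> A + B"
      using A[OF that] B[OF that] by simp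
    finally show ?thesis .
  qed
  then show ?thesis
    unfolding square_summable_iff by blast
qed

lemma square_summable_cmult:
  assumes "square_summable f"
  shows "square_summable (\<lambda>i. c * f i)"
  using summable_on_cmult_right[of "\<lambda>i. (cmod (f i))\<^sup>2" UNIV "(cmod c)\<^sup>2"] assms
  by (simp add: square_summable_def norm_mult power_mult_distrib)

lemma square_summable_uminus: "square_summable f \<Longrightarrow> square_summable (\<lambda>i. - f i)"
  by (simp add: square_summable_def)

lemma square_summable_finite_support:
  assumes "finite {i. f i \<noteq> 0}"
  shows "square_summable f"
  unfolding square_summable_def
  by (rule summable_on_cong_neutral[THEN iffD1, OF _ _ _ summable_on_finite[OF assms]]) auto

typedef 'a ell2 = "Collect square_summable :: ('a \<Rightarrow> complex) set"
  morphisms coord Abs_ell2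
  using square_summable_0 by blast

setup_lifting type_definition_ell2

lemma coord_square_summable: "square_summable (coord u)"
  using coord[of u] by simp

lemma coord_Abs_ell2: "square_summable f \<Longrightarrow> coord (Abs_ell2 f) = f"
  by (simp add: Abs_ell2_inverse)

lemma ell2_eqI: "(\<And>i. coord u i = coord v i) \<Longrightarrow> u = v"
  by (simp add: coord_inject[symmetric] ext)

instantiation ell2 :: (type) real_vector
begin

lift_definition zero_ell2 :: "'a ell2" is "\<lambda>_. 0"
  by (simp add: square_summable_0)

lift_definition plus_ell2 :: "'a ell2 \<Rightarrow> 'a ell2 \<Rightarrow> 'a ell2" is "\<lambda>f g i. f i + g i"
  by (simp add: square_summable_add)

lift_definition uminus_ell2 :: "'a ell2 \<Rightarrow> 'a ell2" is "\<lambda>f i. - f i"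
  by (simp add: square_summable_uminus)

lift_definition minus_ell2 :: "'a ell2 \<Rightarrow> 'a ell2 \<Rightarrow> 'a ell2" is "\<lambda>f g i. f i - g i"
  using square_summable_add square_summable_uminus by fastforce

lift_definition scaleR_ell2 :: "real \<Rightarrow> 'a ell2 \<Rightarrow> 'a ell2" is "\<lambda>r f i. of_real r * f i"
  by (simp add: square_summable_cmult)

instance
  by standard (transfer; simp add: algebra_simps)+

end

lift_definition scaleC_ell2 :: "complex \<Rightarrow> 'a ell2 \<Rightarrow> 'a ell2" is "\<lambda>c f i. c * f i"
  by (simp add: square_summable_cmult)

lemmas coord_simps [simp] =
  zero_ell2.rep_eq plus_ell2.rep_eq uminus_ell2.rep_eq minus_ell2.rep_eq
  scaleR_ell2.rep_eq scaleC_ell2.rep_eq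

instantiation ell2 :: (type) real_normed_vector
begin

definition norm_ell2 :: "'a ell2 \<Rightarrow> real" where
  "norm_ell2 u = sqrt (\<Sum>\<^sub>\<infinity>i. (cmod (coord u i))\<^sup>2)"

definition sgn_ell2 :: "'a ell2 \<Rightarrow> 'a ell2" where
  "sgn_ell2 u = u /\<^sub>R norm u"

definition dist_ell2 :: "'a ell2 \<Rightarrow> 'a ell2 \<Rightarrow> real" where
  "dist_ell2 u v = norm (u - v)"

definition uniformity_ell2 :: "('a ell2 \<times> 'a ell2) filter" where
  "uniformity_ell2 = (INF e\<in>{0<..}. principal {(u, v). dist u v < e})"

definition open_ell2 :: "'a ell2 set \<Rightarrow> bool" where
  "open_ell2 U = (\<forall>u\<in>U. eventually (\<lambda>(u', v). u' = u \<longrightarrow> v \<in> U) uniformity)"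

lemma L2_set_le_norm_ell2:
  assumes "finite F"
  shows "L2_set (\<lambda>i. cmod (coord u i)) F \<le> norm (u :: 'a ell2)"
  unfolding L2_set_def norm_ell2_def
  using coord_square_summable[of u] assms
  by (intro real_sqrt_le_mono finite_sum_le_infsum) (auto simp: square_summable_def)

lemma norm_ell2_leI:
  assumes "\<And>F. finite F \<Longrightarrow> L2_set (\<lambda>i. cmod (coord u i)) F \<le> B"
  shows "norm (u :: 'a ell2) \<le> B"
proof -
  have B: "0 \<le> B"
    using assms[of "{}"] by simp
  have "(\<Sum>i\<in>F. (cmod (coord u i))\<^sup>2) \<le> B\<^sup>2" if "finite F" for F
    using assms[OF that] unfolding L2_set_def by (rule sqrt_le_D)
  then have "(\<Sum>\<^sub>\<infinity>i. (cmod (coord u i))\<^sup>2) \<le> B\<^sup>2"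
    using coord_square_summable[of u]
    by (intro infsum_le_finite_sums) (auto simp: square_summable_def)
  then show ?thesis
    unfolding norm_ell2_def using B by (intro real_le_lsqrt) (auto intro: infsum_nonneg)
qed

lemma norm_coord_le: "cmod (coord u i) \<le> norm (u :: 'a ell2)"
  using L2_set_le_norm_ell2[of "{i}" u] by simp

instance
proof
  fix u v :: "'a ell2" and r :: real
  show "dist u v = norm (u - v)"
    by (rule dist_ell2_def)
  show "sgn u = u /\<^sub>R norm u"
    by (rule sgn_ell2_def)
  show "(uniformity :: ('a ell2 \<times> 'a ell2) filter) = (INF e\<in>{0<..}. principal {(x, y). dist x y < e})"
    by (rule uniformity_ell2_def)
  show "open U \<longleftrightarrow> (\<forall>x\<in>U. eventually (\<lambda>(x', y). x' = x \<longrightarrow> y \<in> U) uniformity)" for U :: "'a ell2 set"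
    by (rule open_ell2_def)
  show "norm u = 0 \<longleftrightarrow> u = 0"
  proof
    assume "norm u = 0"
    then have "cmod (coord u i) \<le> 0" for i
      using norm_coord_le[of u i] by simp
    then show "u = 0"
      by (intro ell2_eqI) simp
  next
    assume "u = 0"
    then show "norm u = 0"
      by (simp add: norm_ell2_def)
  qed
  show "norm (u + v) \<le> norm u + norm v"
  proof (rule norm_ell2_leI)
    fix F :: "'a set"
    assume F: "finite F"
    have "L2_set (\<lambda>i. cmod (coord (u + v) i)) F
        \<le> L2_set (\<lambda>i. cmod (coord u i) + cmod (coord v i)) F"
      by (intro L2_set_mono) (auto simp: norm_triangle_ineq)
    also have "\<dots> \<le> L2_set (\<lambda>i. cmod (coord u i)) F + L2_set (\<lambda>i. cmod (coord v i)) F"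
      by (rule L2_set_triangle_ineq)
    also have "\<dots> \<le> norm u + norm v"
      by (intro add_mono L2_set_le_norm_ell2 F)
    finally show "L2_set (\<lambda>i. cmod (coord (u + v) i)) F \<le> norm u + norm v" .
  qed
  show "norm (r *\<^sub>R u) = \<bar>r\<bar> * norm u"
    by (simp add: norm_ell2_def norm_mult power_mult_distrib infsum_cmult_right' real_sqrt_mult)
qed

end

lemma norm_scaleC_ell2: "norm (scaleC_ell2 c u) = cmod c * norm u"
  by (simp add: norm_ell2_def norm_mult power_mult_distrib infsum_cmult_right' real_sqrt_mult)

lemma bounded_linear_coord: "bounded_linear (\<lambda>u. coord u i)"
  by (rule bounded_linear_intro[where K = 1])
    (auto simp: norm_coord_le scaleR_conv_of_real)

instance ell2 :: (type) banach
proof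
  fix X :: "nat \<Rightarrow> 'a ell2"
  assume X: "Cauchy X"
  have "convergent (\<lambda>n. coord (X n) i)" for i
    using bounded_linear.Cauchy[OF bounded_linear_coord X]
    by (simp add: Cauchy_convergent_iff)
  then obtain l where l: "\<And>i. (\<lambda>n. coord (X n) i) \<longlonglongrightarrow> l i"
    unfolding convergent_def by metis
  have bound: "\<exists>M. \<forall>m\<ge>M. \<forall>F. finite F \<longrightarrow> L2_set (\<lambda>i. cmod (coord (X m) i - l i)) F \<le> e"
    if e: "0 < e" for e
  proof -
    obtain M where M: "\<And>m n. m \<ge> M \<Longrightarrow> n \<ge> M \<Longrightarrow> norm (X m - X n) < e"
      using CauchyD[OF X e] by blast
    have "L2_set (\<lambda>i. cmod (coord (X m) i - l i)) F \<le> e" if m: "m \<ge> M" and F: "finite F" for m F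
    proof (rule LIMSEQ_le_const2)
      show "(\<lambda>n. L2_set (\<lambda>i. cmod (coord (X m) i - coord (X n) i)) F)
          \<longlonglongrightarrow> L2_set (\<lambda>i. cmod (coord (X m) i - l i)) F"
        unfolding L2_set_def by (intro tendsto_intros l)
      show "\<exists>N. \<forall>n\<ge>N. L2_set (\<lambda>i. cmod (coord (X m) i - coord (X n) i)) F \<le> e"
      proof (intro exI allI impI)
        fix n
        assume "n \<ge> M"
        then show "L2_set (\<lambda>i. cmod (coord (X m) i - coord (X n) i)) F \<le> e"
          using L2_set_le_norm_ell2[OF F, of "X m - X n"] M[OF m, of n] by simp
      qed
    qed
    then show ?thesis
      by blast
  qed
  obtain M where "\<forall>F. finite F \<longrightarrow> L2_set (\<lambda>i. cmod (coord (X M) i - l i)) F \<le> 1"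
    using bound[of 1] by auto
  then have "square_summable (\<lambda>i. coord (X M) i - l i)"
    unfolding square_summable_iff by blast
  from square_summable_add[OF coord_square_summable square_summable_uminus[OF this], of "X M"]
  have "square_summable l"
    by simp
  then have L: "coord (Abs_ell2 l) = l"
    by (rule coord_Abs_ell2)
  have "X \<longlonglongrightarrow> Abs_ell2 l"
  proof (rule LIMSEQ_I)
    fix r :: real
    assume r: "0 < r"
    obtain M where M: "\<And>m F. m \<ge> M \<Longrightarrow> finite F \<Longrightarrow>
        L2_set (\<lambda>i. cmod (coord (X m) i - l i)) F \<le> r / 2"
      using bound[of "r / 2"] r by auto
    have "norm (X m - Abs_ell2 l) < r" if "m \<ge> M" for m
      using norm_ell2_leI[of "X m - Abs_ell2 l" "r / 2"] M[OF that] L r by auto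
    then show "\<exists>M. \<forall>m\<ge>M. norm (X m - Abs_ell2 l) < r"
      by blast
  qed
  then show "convergent X"
    by (rule convergentI)
qed

definition cinner_ell2 :: "'a ell2 \<Rightarrow> 'a ell2 \<Rightarrow> complex" where
  "cinner_ell2 u v = (\<Sum>\<^sub>\<infinity>i. cnj (coord u i) * coord v i)"

lift_definition delta :: "'a \<Rightarrow> 'a ell2" is "\<lambda>n i. if i = n then 1 else 0"
  by (simp add: square_summable_finite_support)

lemma cinner_delta: "cinner_ell2 (delta n) u = coord u n"
proof -
  have "cinner_ell2 (delta n) u = (\<Sum>\<^sub>\<infinity>i\<in>{n}. coord u i)"
    unfolding cinner_ell2_def by (rule infsum_cong_neutral) (auto simp: delta.rep_eq)
  then show ?thesis
    by simp
qed

lemma norm_delta: "norm (delta n) = 1"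
proof -
  have "(\<Sum>\<^sub>\<infinity>i. (cmod (coord (delta n) i))\<^sup>2) = (\<Sum>\<^sub>\<infinity>i\<in>{n}. 1)"
    by (rule infsum_cong_neutral) (auto simp: delta.rep_eq)
  then show ?thesis
    by (simp add: norm_ell2_def)
qed


section \<open>Bounded operators\<close>

text \<open>
  The type \<open>'a ell2 \<Rightarrow>\<^sub>L 'a ell2\<close> consists of the real-linear bounded operators. The
  complex-linear ones form a closed subalgebra with the same operator norm, and the operators
  below lie in it.
\<close>

definition scaleC_op :: "complex \<Rightarrow> ('a ell2 \<Rightarrow>\<^sub>L 'a ell2) \<Rightarrow> ('a ell2 \<Rightarrow>\<^sub>L 'a ell2)" where
  "scaleC_op c A = Blinfun (\<lambda>u. scaleC_ell2 c (A u))"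

lemma scaleC_op_apply: "scaleC_op c A u = scaleC_ell2 c (A u)"
proof -
  have "bounded_linear (\<lambda>u. scaleC_ell2 c (A u))"
  proof (rule bounded_linear_intro[where K = "norm A * cmod c"])
    show "norm (scaleC_ell2 c (A u)) \<le> norm u * (norm A * cmod c)" for u
      using mult_left_mono[OF norm_blinfun[of A u], of "cmod c"]
      by (simp add: norm_scaleC_ell2 mult_ac)
  qed (auto intro!: ell2_eqI simp: blinfun.bilinear_simps algebra_simps)
  then show ?thesis
    unfolding scaleC_op_def by (simp add: bounded_linear_Blinfun_apply)
qed

definition op_power :: "'b::real_normed_vector \<Rightarrow>\<^sub>L 'b \<Rightarrow> nat \<Rightarrow> 'b \<Rightarrow>\<^sub>L 'b" where
  "op_power A n = ((\<lambda>B. A o\<^sub>L B) ^^ n) id_blinfun"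

definition op_exp :: "'b::banach \<Rightarrow>\<^sub>L 'b \<Rightarrow> 'b \<Rightarrow>\<^sub>L 'b" where
  "op_exp A = (\<Sum>n. op_power A n /\<^sub>R fact n)"

lemma norm_op_power_le: "norm (op_power A n) \<le> norm A ^ n"
proof (induction n)
  case 0
  show ?case
    by (simp add: op_power_def norm_blinfun_id_le)
next
  case (Suc n)
  have "norm (op_power A (Suc n)) \<le> norm A * norm (op_power A n)"
    by (simp add: op_power_def norm_blinfun_compose)
  also have "\<dots> \<le> norm A * norm A ^ n"
    by (intro mult_left_mono Suc.IH) simp
  finally show ?case
    by simp
qed

lemma op_exp_sums: "(\<lambda>n. op_power A n /\<^sub>R fact n) sums op_exp A"
proof -
  have "summable (\<lambda>n. op_power A n /\<^sub>R fact n)"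
  proof (rule summable_comparison_test)
    show "\<exists>N. \<forall>n\<ge>N. norm (op_power A n /\<^sub>R fact n) \<le> norm A ^ n /\<^sub>R fact n"
      by (intro exI[of _ 0] allI impI) (simp add: norm_op_power_le mult_left_mono)
    show "summable (\<lambda>n. norm A ^ n /\<^sub>R fact n)"
      by (rule summable_exp_generic)
  qed
  then show ?thesis
    unfolding op_exp_def by (rule summable_sums)
qed

definition norm_l1_linf :: "'a ell2 \<Rightarrow>\<^sub>L 'a ell2 \<Rightarrow> real" where
  "norm_l1_linf A = (SUP (n, m)\<in>UNIV. cmod (cinner_ell2 (delta n) (A (delta m))))"

lemma cmod_entry_le:
  fixes A :: "'a ell2 \<Rightarrow>\<^sub>L 'a ell2"
  shows "cmod (cinner_ell2 (delta n) (A (delta m))) \<le> norm A"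
  using norm_coord_le[of "A (delta m)" n] norm_blinfun[of A "delta m"]
  by (simp add: cinner_delta norm_delta)

lemma bdd_above_entries:
  fixes A :: "'a ell2 \<Rightarrow>\<^sub>L 'a ell2"
  shows
  "bdd_above ((\<lambda>(n, m). cmod (cinner_ell2 (delta n) (A (delta m)))) ` UNIV)"
  by (rule bdd_aboveI[where M = "norm A"]) (auto simp: cmod_entry_le)


section \<open>The operator \<open>H_w\<close>\<close>

text \<open>Meaningful for absolutely summable \<open>w\<close>; see \<open>H_op_apply\<close>.\<close>

definition H_op :: "(int \<Rightarrow> real) \<Rightarrow> int ell2 \<Rightarrow>\<^sub>L int ell2" where
  "H_op w = Blinfun (\<lambda>u. Abs_ell2 (\<lambda>n. \<Sum>\<^sub>\<infinity>k. of_real (w k) * coord u (n + k)))"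

lift_definition shift :: "int \<Rightarrow> int ell2 \<Rightarrow> int ell2" is "\<lambda>k f n. f (n + k)"
proof -
  fix k :: int and f :: "int \<Rightarrow> complex"
  assume "f \<in> Collect square_summable"
  moreover have "bij (\<lambda>n. n + k)"
    by (rule bijI') (auto intro: exI[of _ "y - k" for y])
  ultimately show "(\<lambda>n. f (n + k)) \<in> Collect square_summable"
    using summable_on_reindex_bij_betw[of "\<lambda>n. n + k" UNIV UNIV "\<lambda>i. (cmod (f i))\<^sup>2"]
    by (simp add: square_summable_def)
qed

lemma norm_shift: "norm (shift k u) = norm u"
proof -
  have "bij (\<lambda>n. n + k)"
    by (rule bijI') (auto intro: exI[of _ "y - k" for y])
  then show ?thesis
    using infsum_reindex_bij_betw[of "\<lambda>n. n + k" UNIV UNIV "\<lambda>i. (cmod (coord u i))\<^sup>2"]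
    by (simp add: norm_ell2_def shift.rep_eq)
qed

lemma H_op_apply:
  assumes w: "(\<lambda>k. norm (w k)) summable_on UNIV"
  shows "coord (H_op w u) n = (\<Sum>\<^sub>\<infinity>k. of_real (w k) * coord u (n + k))"
proof -
  have shift: "bounded_linear (shift k)" for k
    by (rule bounded_linear_intro[where K = 1])
      (auto intro!: ell2_eqI simp: norm_shift shift.rep_eq)
  define T where "T k = w k *\<^sub>R Blinfun (shift k)" for k
  have T: "coord (T k u) n = of_real (w k) * coord u (n + k)" for k u n
    by (simp add: T_def shift bounded_linear_Blinfun_apply shift.rep_eq scaleR_blinfun.rep_eq)
  have "norm (Blinfun (shift k)) \<le> 1" for k
    by (rule norm_blinfun_bound) (auto simp: shift bounded_linear_Blinfun_apply norm_shift)
  then have "norm (T k) \<le> norm (w k)" for k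
    unfolding T_def using mult_left_le[of "norm (Blinfun (shift k))" "\<bar>w k\<bar>"] by simp
  then have "(\<lambda>k. norm (T k)) summable_on UNIV"
    using Infinite_Sum.abs_summable_on_comparison_test[OF w, of T] by simp
  then have "T summable_on UNIV"
    by (rule abs_summable_summable)
  then obtain S where sum: "(T has_sum S) UNIV"
    unfolding summable_on_def by blast
  have coord: "coord (S u) n = (\<Sum>\<^sub>\<infinity>k. of_real (w k) * coord u (n + k))" for u n
  proof -
    have "bounded_linear (\<lambda>A. coord (blinfun_apply A u) n)"
      by (rule bounded_linear_compose[OF bounded_linear_coord blinfun.bounded_linear_left])
    from has_sum_bounded_linear[OF this sum]
    have "((\<lambda>k. of_real (w k) * coord u (n + k)) has_sum coord (S u) n) UNIV"
      by (simp add: T)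
    then show ?thesis
      by (simp add: infsumI)
  qed
  have "Abs_ell2 (\<lambda>n. \<Sum>\<^sub>\<infinity>k. of_real (w k) * coord u (n + k)) = S u" for u
    unfolding coord[symmetric] by (rule coord_inverse)
  then have "H_op w = S"
    by (simp add: H_op_def blinfun_apply_inverse)
  then show ?thesis
    by (simp add: coord)
qed

end

theory Submission
  imports Defs
begin

text \<open>
In the Fourier representation \<open>H\<^sub>w\<close> is multiplication by \<open>2 W\<close>, where
\<open>W x = \<Sum>j. cos (2 \<pi> \<lambda>\<^sup>j x) / 2\<^sup>j\<close> is a Weierstrass function. So the entries of \<open>exp (- i t H\<^sub>w)\<close> are
oscillatory integrals \<open>\<integral> cis (b x - 2 t W x) dx\<close> over \<open>[0, 1]\<close> with a linear term \<open>b x\<close>, and the task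
is to bound such integrals by \<open>T\<^sup>-\<^sup>N\<close> for \<open>T = 2 \<bar>t\<bar>\<close>, uniformly in \<open>b\<close>. A single stationary point of a
cosine gives no more than \<open>T\<^sup>-\<^sup>1\<^sup>/\<^sup>2\<close>; the point is to gain a factor \<open>2\<^sup>-\<^sup>N\<close> from each of the \<open>log\<^sub>2 T\<close> scales
at which the amplitude \<open>T / 2\<^sup>j\<close> is still large. This is done by a renormalisation step for the supremum
\<open>V T\<close> of all integrals \<open>\<integral> a x * cis (M x + T W x) dx\<close> in which \<open>a\<close> and \<open>M\<close> vary slowly in the sense
that \<open>a\<close> and \<open>a'\<close> are bounded by 1 and \<open>M''\<close> by \<open>T / \<lambda>\<close>; the linear part of \<open>M\<close> is free.

The step rests on the self-similarity \<open>W x = W\<^sub>p x + W (\<lambda>\<^sup>p x) / 2\<^sup>p\<close>, where \<open>W\<^sub>p\<close> consists of the first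
\<open>p\<close> terms. Folding the interval by \<open>x = (k + y) / \<lambda>\<^sup>p\<close> leaves \<open>W y / 2\<^sup>p\<close> as a common phase, with
an amplitude \<open>A y\<close> that is the average of \<open>\<lambda>\<^sup>p\<close> smooth waves, one for each \<open>k\<close>.

The average is small in mean square (\<open>integral_avg_square_le\<close>). Indeed, the square of \<open>A\<close> is a double
sum over pairs of waves. If the two waves have different frequencies at \<open>y\<close>, integration by parts
shows that the pair contributes little (\<open>oscillatory_integral_le\<close>). Coincidences are rare: the
frequency of the \<open>k\<close>-th wave is essentially \<open>W\<^sub>p'\<close> at the point \<open>(k + y) / \<lambda>\<^sup>p\<close>, and each base \<open>\<lambda>\<close>
digit of \<open>k\<close> that has to be adjusted in order to hit a prescribed value costs a factor of order
\<open>\<lambda>\<^sup>-\<^sup>1\<^sup>/\<^sup>2\<close> (\<open>card_weier_slope_near_le\<close>). Altogether the integral of \<open>\<bar>A\<bar>\<close> is at most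
\<open>(18 / sqrt \<lambda>)\<^sup>p\<^sup>/\<^sup>2\<close>.

The average is also slowly varying: once a common linear phase is removed, its derivative is \<open>O(T)\<close>.
So on intervals of length \<open>\<lambda>\<^sup>-\<^sup>r\<close>, with \<open>\<lambda>\<^sup>r\<close> much larger than \<open>T\<close>, it is nearly constant, while the \<open>r\<close>
next frequencies of \<open>W\<close> become a slow phase there. What remains on each such interval is an integral of
the same class with amplitude \<open>T / 2\<^sup>p\<^sup>+\<^sup>r\<close>. Hence \<open>V T \<le> G * V (T / 2\<^sup>p\<^sup>+\<^sup>r)\<close> with a gain \<open>G\<close> that is a
negative power of \<open>\<lambda>\<close> with exponent proportional to \<open>p\<close> (\<open>osc_integral_step\<close>). For \<open>T\<close> between \<open>\<lambda>\<^sup>8\<^sup>p\<close> and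
\<open>\<lambda>\<^sup>8\<^sup>p\<^sup>+\<^sup>8\<close> the number \<open>r\<close> may be chosen comparable to \<open>p\<close>, so that a large \<open>\<lambda>\<close> turns \<open>G\<close> into less than
\<open>2\<^sup>-\<^sup>N\<close> for each of the \<open>p + r\<close> scales (\<open>block_gain\<close>). Iteration gives \<open>V T \<le> (\<lambda>\<^sup>8 / T)\<^sup>N\<close>. Applied with
\<open>N + 1\<close> in place of \<open>N\<close>, this bound is below \<open>T\<^sup>-\<^sup>N\<close> for all large \<open>T\<close>, where the threshold depends on
\<open>\<lambda>\<close> but the constant does not.
\<close>

section \<open>Integration on the unit interval\<close>

lemma cis_has_vector_derivative:
  assumes "(\<theta> has_real_derivative d) (at x)"
  shows "((\<lambda>x. cis (\<theta> x)) has_vector_derivative (\<i> * of_real d * cis (\<theta> x))) (at x)"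
proof -
  have "((\<lambda>x. of_real (cos (\<theta> x)) + \<i> * of_real (sin (\<theta> x))) has_vector_derivative
      (of_real (- sin (\<theta> x) * d) + \<i> * of_real (cos (\<theta> x) * d))) (at x)"
    by (intro has_vector_derivative_add has_vector_derivative_mult_right has_vector_derivative_of_real)
      (auto intro!: derivative_eq_intros assms)
  moreover have "(\<lambda>x. cis (\<theta> x)) = (\<lambda>x. of_real (cos (\<theta> x)) + \<i> * of_real (sin (\<theta> x)))"
    by (simp add: complex_eq_iff fun_eq_iff)
  moreover have "of_real (- sin (\<theta> x) * d) + \<i> * of_real (cos (\<theta> x) * d) = \<i> * of_real d * cis (\<theta> x)"
    by (simp add: complex_eq_iff)
  ultimately show ?thesis
    by metis
qed

lemma continuous_on_cis_real [continuous_intros]: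
  "continuous_on S \<theta> \<Longrightarrow> continuous_on S (\<lambda>x. cis (\<theta> x))"
  unfolding cis_conv_exp by (intro continuous_intros)

text \<open>
Folding \<open>[0, 1]\<close> onto itself by \<open>x \<mapsto> n x mod 1\<close> preserves Lebesgue measure; the sum on the right
runs over the inverse branches.
\<close>

lemma integral_average_over_cells:
  fixes F :: "real \<Rightarrow> 'b::banach"
  assumes F: "continuous_on UNIV F" and n: "n > 0"
  shows "integral {0..1} F = integral {0..1} (\<lambda>y. (\<Sum>k<n. F ((real k + y) / real n)) /\<^sub>R real n)"
proof -
  have int: "F integrable_on {a..b}" for a b
    using F integrable_continuous_interval continuous_on_subset by blast
  have cell: "((\<lambda>y. F ((real k + y) / real n) /\<^sub>R real n) has_integral
      integral {real k / n .. real (Suc k) / n} F) {0..1}" for k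
  proof -
    have "((\<lambda>y. F ((1 / real n) *\<^sub>R y + real k / n)) has_integral
       (integral {real k / n .. real (Suc k) / n} F /\<^sub>R (1 / real n) ^ DIM(real)))
         (cbox ((real k / n - real k / n) /\<^sub>R (1 / real n)) ((real (Suc k) / n - real k / n) /\<^sub>R (1 / real n)))"
      using n by (intro has_integral_affinity') (auto simp: int integrable_integral)
    then have "((\<lambda>y. F ((real k + y) / real n)) has_integral
       (real n *\<^sub>R integral {real k / n .. real (Suc k) / n} F)) {0..1}"
      using n by (simp add: add_divide_distrib diff_divide_distrib add.commute)
    from has_integral_cmul[OF this, of "inverse (real n)"] show ?thesis
      using n by simp
  qed
  have "(F has_integral (\<Sum>k<m. integral {real k / n .. real (Suc k) / n} F)) {0..real m / n}" for m
  proof (induction m)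
    case 0
    then show ?case by (simp add: has_integral_refl(2))
  next
    case (Suc m)
    have "(F has_integral (\<Sum>k<m. integral {real k / n .. real (Suc k) / n} F)
        + integral {real m / n .. real (Suc m) / n} F) {0..real (Suc m) / n}"
      by (rule has_integral_combine[OF _ _ Suc])
        (use n in \<open>auto simp: int integrable_integral divide_right_mono\<close>)
    then show ?case by simp
  qed
  from this[of n] have "integral {0..1} F = (\<Sum>k<n. integral {real k / n .. real (Suc k) / n} F)"
    using n by (simp add: integral_unique)
  also have "\<dots> = integral {0..1} (\<lambda>y. \<Sum>k<n. F ((real k + y) / real n) /\<^sub>R real n)"
    by (rule integral_unique[symmetric]) (intro has_integral_sum cell finite_lessThan)
  finally show ?thesis
    by (simp add: scaleR_sum_right)
qed

text \<open>
The affine map of \<open>[0, 1]\<close> onto the \<open>k\<close>-th interval of length \<open>l\<^sup>-\<^sup>n\<close>. It serves both as the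
\<open>k\<close>-th inverse branch of \<open>x \<mapsto> l\<^sup>n x mod 1\<close> and as the zoom into a short interval.
\<close>

definition cell :: "nat \<Rightarrow> nat \<Rightarrow> nat \<Rightarrow> real \<Rightarrow> real" where
  "cell l n k y = (real k + y) / real l ^ n"

lemma cell_deriv:
  assumes "l > 0"
  shows "(cell l n k has_real_derivative 1 / real l ^ n) (at y)"
  unfolding cell_def[abs_def] using assms by (auto intro!: derivative_eq_intros)

lemma cell_in:
  assumes "k < l ^ n" "y \<in> {0..1}"
  shows "cell l n k y \<in> {0..1}"
proof -
  have "real k + 1 \<le> real l ^ n"
    using assms(1) by (metis Suc_leI of_nat_Suc of_nat_le_iff of_nat_power add.commute)
  then show ?thesis
    using assms(2) by (auto simp: cell_def divide_le_eq)
qed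

lemma continuous_on_cell:
  assumes "l > 0"
  shows "continuous_on S (cell l n k)"
  unfolding cell_def[abs_def] using assms by (intro continuous_intros) auto

text \<open>
On \<open>[0, 1]\<close> a derivative bound is a bound for the total oscillation.
\<close>

lemma norm_diff_le_derivative_bound:
  fixes f :: "real \<Rightarrow> 'a::real_normed_vector"
  assumes "\<And>x. (f has_vector_derivative f' x) (at x)"
    and "\<And>x. x \<in> {0..1} \<Longrightarrow> norm (f' x) \<le> B"
    and "x \<in> {0..1}" "y \<in> {0..1}"
  shows "norm (f x - f y) \<le> B"
proof -
  have "norm (f x - f y) \<le> B * norm (x - y)"
  proof (rule differentiable_bound[of "{0..1}" f "\<lambda>x h. h *\<^sub>R f' x"])
    fix x :: real assume "x \<in> {0..1}"
    show "(f has_derivative (\<lambda>h. h *\<^sub>R f' x)) (at x within {0..1})"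
      using assms(1)[of x] has_vector_derivative_at_within has_vector_derivative_def by blast
    show "onorm (\<lambda>h. h *\<^sub>R f' x) \<le> B"
      using assms(2)[OF \<open>x \<in> {0..1}\<close>]
      by (intro onorm_le) (simp add: mult.commute[of B] mult_left_mono)
  qed (use assms in auto)
  also have "\<dots> \<le> B * 1"
  proof (rule mult_left_mono)
    show "0 \<le> B"
      using assms(2)[of 0] norm_ge_zero[of "f' 0"] by (simp del: norm_ge_zero)
  qed (use assms(3,4) in auto)
  finally show ?thesis by simp
qed

text \<open>
Non-stationary phase without any assumption on the zeros of \<open>\<theta>'\<close>. Instead of cutting the interval
into pieces where \<open>\<theta>'\<close> is large or small, the constant 1 is split smoothly into
\<open>\<theta>'\<^sup>2 / (\<epsilon>\<^sup>2 + \<theta>'\<^sup>2)\<close> and \<open>\<epsilon>\<^sup>2 / (\<epsilon>\<^sup>2 + \<theta>'\<^sup>2)\<close>. The first part carries a factor \<open>\<theta>'\<close> and is integrated by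
parts against \<open>(cis \<theta>)'\<close>; the second is bounded trivially and measures how close \<open>\<theta>\<close> is to being
stationary.
\<close>

lemma oscillatory_integral_le:
  fixes c c' :: "real \<Rightarrow> complex" and \<theta> \<theta>' \<theta>'' :: "real \<Rightarrow> real"
  assumes dc: "\<And>x. (c has_vector_derivative c' x) (at x)"
    and d1: "\<And>x. (\<theta> has_real_derivative \<theta>' x) (at x)"
    and d2: "\<And>x. (\<theta>' has_real_derivative \<theta>'' x) (at x)"
    and c: "\<And>x. x \<in> {0..1} \<Longrightarrow> norm (c x) \<le> 1"
    and c': "\<And>x. x \<in> {0..1} \<Longrightarrow> norm (c' x) \<le> 2"
    and \<nu>: "\<And>x. x \<in> {0..1} \<Longrightarrow> \<bar>\<theta>'' x\<bar> \<le> \<nu>"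
    and \<epsilon>: "\<epsilon> > 0"
  shows "norm (integral {0..1} (\<lambda>x. c x * cis (\<theta> x)))
    \<le> 2 / \<epsilon> + \<nu> / \<epsilon>\<^sup>2 + integral {0..1} (\<lambda>x. \<epsilon>\<^sup>2 / (\<epsilon>\<^sup>2 + (\<theta>' x)\<^sup>2))"
proof -
  define \<rho> where "\<rho> x = \<theta>' x / (\<epsilon>\<^sup>2 + (\<theta>' x)\<^sup>2)" for x
  define \<rho>' where "\<rho>' x = \<theta>'' x * (\<epsilon>\<^sup>2 - (\<theta>' x)\<^sup>2) / (\<epsilon>\<^sup>2 + (\<theta>' x)\<^sup>2)\<^sup>2" for x
  define w where "w x = \<epsilon>\<^sup>2 / (\<epsilon>\<^sup>2 + (\<theta>' x)\<^sup>2)" for x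
  define F where "F x = c x * (cis (\<theta> x) * of_real (\<rho> x))" for x
  define g where "g x = c x * cis (\<theta> x) * of_real (1 - w x)" for x
  define e where "e x = c x * (cis (\<theta> x) * of_real (\<rho>' x)) + c' x * (cis (\<theta> x) * of_real (\<rho> x))" for x
  have pos: "\<epsilon>\<^sup>2 + (\<theta>' x)\<^sup>2 > 0" for x
    using \<epsilon> by (intro add_pos_nonneg) auto
  have pos0: "\<epsilon>\<^sup>2 + (\<theta>' x)\<^sup>2 \<noteq> 0" for x
    using pos[of x] by (metis less_irrefl)
  have one_w: "1 - w x = \<theta>' x * \<rho> x" for x
    unfolding w_def \<rho>_def using pos0[of x] by (simp add: field_simps power2_eq_square)
  have d\<rho>: "(\<rho> has_real_derivative \<rho>' x) (at x)" for x
    unfolding \<rho>_def[abs_def] \<rho>'_def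
    by (rule derivative_eq_intros d2 refl pos0)+ (simp add: power2_eq_square algebra_simps)
  have dF: "(F has_vector_derivative (\<i> * g x + e x)) (at x)" for x
  proof -
    have "(F has_vector_derivative c x * (cis (\<theta> x) * of_real (\<rho>' x) + \<i> * of_real (\<theta>' x) * cis (\<theta> x) * of_real (\<rho> x))
        + c' x * (cis (\<theta> x) * of_real (\<rho> x))) (at x)"
      unfolding F_def[abs_def]
      by (intro has_vector_derivative_mult dc cis_has_vector_derivative d1 has_vector_derivative_of_real d\<rho>)
    then show ?thesis
      unfolding g_def e_def one_w by (simp add: algebra_simps)
  qed
  have cont_c: "continuous_on S c" for S
    using dc by (meson continuous_at_imp_continuous_on has_vector_derivative_continuous)
  have cont_\<theta>: "continuous_on S \<theta>" for S
    using d1 by (meson DERIV_continuous continuous_at_imp_continuous_on)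
  have cont_\<theta>': "continuous_on S \<theta>'" for S
    using d2 by (meson DERIV_continuous continuous_at_imp_continuous_on)
  have cont_w: "continuous_on S w" for S
    unfolding w_def[abs_def] by (intro continuous_intros cont_\<theta>') (use pos0 in auto)
  have cont_g: "continuous_on S g" for S
    unfolding g_def[abs_def] by (intro continuous_intros cont_c cont_\<theta> cont_w)
  have ig: "(\<lambda>x. \<i> * g x) integrable_on {0..1}"
    by (intro integrable_continuous_interval continuous_intros cont_g)
  have FTC: "((\<lambda>x. \<i> * g x + e x) has_integral F 1 - F 0) {0..1}"
    by (rule fundamental_theorem_of_calculus) (auto intro: has_vector_derivative_at_within dF)
  \<comment> \<open>\<open>c'\<close> and \<open>\<theta>''\<close> may be discontinuous, so \<open>e\<close> is integrable only as a difference of two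
    integrable functions\<close>
  have e_int: "(e has_integral (F 1 - F 0 - integral {0..1} (\<lambda>x. \<i> * g x))) {0..1}"
    using has_integral_diff[OF FTC integrable_integral[OF ig]] by simp
  \<comment> \<open>AM-GM: \<open>2 \<epsilon> \<bar>\<theta>'\<bar> \<le> \<epsilon>\<^sup>2 + \<theta>'\<^sup>2\<close>\<close>
  have \<rho>b: "\<bar>\<rho> x\<bar> \<le> 1 / (2 * \<epsilon>)" for x
  proof -
    have "0 \<le> (\<epsilon> - \<bar>\<theta>' x\<bar>)\<^sup>2" by simp
    then have "2 * \<epsilon> * \<bar>\<theta>' x\<bar> \<le> \<epsilon>\<^sup>2 + (\<theta>' x)\<^sup>2"
      by (simp add: power2_diff)
    then show ?thesis
      unfolding \<rho>_def using pos[of x] \<epsilon> by (simp add: abs_divide field_simps)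
  qed
  have \<rho>'b: "\<bar>\<rho>' x\<bar> \<le> \<nu> / \<epsilon>\<^sup>2" if "x \<in> {0..1}" for x
  proof -
    have "\<bar>\<epsilon>\<^sup>2 - (\<theta>' x)\<^sup>2\<bar> \<le> \<epsilon>\<^sup>2 + (\<theta>' x)\<^sup>2"
      by (simp add: abs_le_iff)
    then have "\<bar>\<rho>' x\<bar> \<le> \<bar>\<theta>'' x\<bar> * (\<epsilon>\<^sup>2 + (\<theta>' x)\<^sup>2) / (\<epsilon>\<^sup>2 + (\<theta>' x)\<^sup>2)\<^sup>2"
      unfolding \<rho>'_def abs_divide abs_mult by (intro divide_mono mult_left_mono) (use pos[of x] in auto)
    also have "\<dots> = \<bar>\<theta>'' x\<bar> / (\<epsilon>\<^sup>2 + (\<theta>' x)\<^sup>2)"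
      using pos0[of x] by (simp add: power2_eq_square)
    also have "\<dots> \<le> \<nu> / \<epsilon>\<^sup>2"
      using \<nu>[OF that] \<epsilon> by (intro frac_le) auto
    finally show ?thesis .
  qed
  have "norm (e x) \<le> \<nu> / \<epsilon>\<^sup>2 + 1 / \<epsilon>" if x: "x \<in> {0..1}" for x
  proof -
    have "norm (e x) \<le> norm (c x) * \<bar>\<rho>' x\<bar> + norm (c' x) * \<bar>\<rho> x\<bar>"
      unfolding e_def by (rule norm_triangle_le) (simp add: norm_mult)
    also have "\<dots> \<le> 1 * (\<nu> / \<epsilon>\<^sup>2) + 2 * (1 / (2 * \<epsilon>))"
      by (intro add_mono mult_mono c c' x \<rho>b \<rho>'b) auto
    finally show ?thesis by simp
  qed
  moreover have "0 \<le> \<nu> / \<epsilon>\<^sup>2 + 1 / \<epsilon>"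
    using \<nu>[of 0] \<epsilon> by auto
  ultimately have eb: "norm (F 1 - F 0 - integral {0..1} (\<lambda>x. \<i> * g x)) \<le> \<nu> / \<epsilon>\<^sup>2 + 1 / \<epsilon>"
    using has_integral_bound_real[OF _ _ e_int, of "\<nu> / \<epsilon>\<^sup>2 + 1 / \<epsilon>" "{}"] by simp
  have Fb: "norm (F x) \<le> 1 / (2 * \<epsilon>)" if "x \<in> {0..1}" for x
    unfolding F_def using mult_mono[OF c[OF that] \<rho>b[of x]] by (simp add: norm_mult)
  have "norm (integral {0..1} (\<lambda>x. \<i> * g x)) \<le> norm (F 1) + norm (F 0)
      + norm (F 1 - F 0 - integral {0..1} (\<lambda>x. \<i> * g x))"
    by (smt (verit) norm_minus_commute norm_triangle_ineq4 norm_triangle_sub)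
  also have "\<dots> \<le> 1 / (2 * \<epsilon>) + 1 / (2 * \<epsilon>) + (\<nu> / \<epsilon>\<^sup>2 + 1 / \<epsilon>)"
    by (intro add_mono Fb eb) auto
  finally have main: "norm (integral {0..1} g) \<le> 2 / \<epsilon> + \<nu> / \<epsilon>\<^sup>2"
    by (simp add: norm_mult)
  have "norm (c x * cis (\<theta> x) * of_real (w x)) \<le> w x" if "x \<in> {0..1}" for x
  proof -
    have "0 \<le> w x"
      using pos[of x] by (simp add: w_def)
    then show ?thesis
      using mult_right_mono[OF c[OF that], of "w x"] by (simp add: norm_mult)
  qed
  then have rest: "norm (integral {0..1} (\<lambda>x. c x * cis (\<theta> x) * of_real (w x))) \<le> integral {0..1} w"
    by (intro integral_norm_bound_integral integrable_continuous_interval)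
      (auto intro!: continuous_intros cont_c cont_\<theta> cont_w)
  have "integral {0..1} (\<lambda>x. c x * cis (\<theta> x)) = integral {0..1} (\<lambda>x. g x + c x * cis (\<theta> x) * of_real (w x))"
    by (simp add: g_def algebra_simps)
  also have "\<dots> = integral {0..1} g + integral {0..1} (\<lambda>x. c x * cis (\<theta> x) * of_real (w x))"
    by (intro integral_add integrable_continuous_interval)
      (auto intro!: continuous_intros cont_c cont_\<theta> cont_w cont_g)
  also have "norm \<dots> \<le> (2 / \<epsilon> + \<nu> / \<epsilon>\<^sup>2) + integral {0..1} w"
    using main rest by (intro norm_triangle_le add_mono)
  finally show ?thesis
    by (simp add: w_def[abs_def])
qed

section \<open>The Weierstrass function\<close>

definition weier :: "nat \<Rightarrow> real \<Rightarrow> real" where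
  "weier l x = (\<Sum>j. cos (2 * pi * real l ^ j * x) / 2 ^ j)"

definition weier_sum :: "nat \<Rightarrow> nat \<Rightarrow> real \<Rightarrow> real" where
  "weier_sum l p x = (\<Sum>j<p. cos (2 * pi * real l ^ j * x) / 2 ^ j)"

text \<open>
The derivative of \<open>weier_sum l p\<close> is \<open>- 2 \<pi>\<close> times \<open>weier_slope l p\<close>, and the derivative of
\<open>weier_slope l p\<close> is \<open>weier_curv l p\<close>.
\<close>

definition weier_slope :: "nat \<Rightarrow> nat \<Rightarrow> real \<Rightarrow> real" where
  "weier_slope l p x = (\<Sum>j<p. (real l / 2) ^ j * sin (2 * pi * real l ^ j * x))"

definition weier_curv :: "nat \<Rightarrow> nat \<Rightarrow> real \<Rightarrow> real" where
  "weier_curv l p x = 2 * pi * (\<Sum>j<p. ((real l)\<^sup>2 / 2) ^ j * cos (2 * pi * real l ^ j * x))"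

lemma summable_half_power: "summable (\<lambda>j. 1 / 2 ^ j :: real)"
  using summable_geometric[of "1 / 2 :: real"] by (simp add: power_divide)

lemma weier_summable: "summable (\<lambda>j. cos (2 * pi * real l ^ j * x) / 2 ^ j)"
  by (rule summable_comparison_test'[OF summable_half_power, of 0]) (simp add: divide_right_mono)

lemma abs_weier_le: "\<bar>weier l x\<bar> \<le> 2"
proof -
  have "(\<lambda>j. (1 / 2) ^ j :: real) sums (1 / (1 - 1 / 2))"
    by (rule geometric_sums) simp
  then have s: "(\<lambda>j. 1 / 2 ^ j :: real) sums 2"
    by (simp add: power_divide)
  have "norm (\<Sum>j. cos (2 * pi * real l ^ j * x) / 2 ^ j) \<le> (\<Sum>j. 1 / 2 ^ j)"
    by (rule norm_suminf_le[OF _ summable_half_power]) (simp add: divide_right_mono)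
  then show ?thesis
    using sums_unique[OF s] by (simp add: weier_def)
qed

lemma continuous_on_weier: "continuous_on S (weier l)"
proof -
  have "uniform_limit UNIV (\<lambda>n x. \<Sum>j<n. cos (2 * pi * real l ^ j * x) / 2 ^ j) (weier l) sequentially"
    unfolding weier_def[abs_def]
    by (rule Weierstrass_m_test[OF _ summable_half_power]) (simp add: divide_right_mono)
  then have "continuous_on UNIV (weier l)"
    by (rule uniform_limit_theorem[rotated]) (auto intro!: always_eventually continuous_intros)
  then show ?thesis
    using continuous_on_subset by blast
qed

text \<open>
Self-similarity: beyond its first \<open>p\<close> terms the function is a copy of itself, at frequency \<open>l\<^sup>p\<close>
and with amplitude \<open>2\<^sup>-\<^sup>p\<close>. The whole proof is an induction along this identity.
\<close>

lemma weier_split: "weier l x = weier_sum l p x + weier l (real l ^ p * x) / 2 ^ p"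
proof -
  have "weier l x = (\<Sum>j. cos (2 * pi * real l ^ (j + p) * x) / 2 ^ (j + p)) + weier_sum l p x"
    unfolding weier_def weier_sum_def by (rule suminf_split_initial_segment[OF weier_summable])
  also have "(\<Sum>j. cos (2 * pi * real l ^ (j + p) * x) / 2 ^ (j + p)) =
      (\<Sum>j. cos (2 * pi * real l ^ j * (real l ^ p * x)) / 2 ^ j / 2 ^ p)"
    by (simp add: power_add mult_ac)
  also have "\<dots> = weier l (real l ^ p * x) / 2 ^ p"
    unfolding weier_def by (rule suminf_divide[OF weier_summable])
  finally show ?thesis by simp
qed

lemma weier_plus_nat: "weier l (real k + x) = weier l x"
proof -
  have "cos (2 * pi * real l ^ j * (real k + x)) = cos (2 * pi * real l ^ j * x)" for j
  proof -
    have "2 * pi * real l ^ j * (real k + x) = 2 * pi * real l ^ j * x + 2 * real (l ^ j * k) * pi"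
      by (simp add: algebra_simps)
    then show ?thesis
      by (simp only: cos_add sin_2npi cos_2npi mult_1_right mult_zero_right diff_0_right)
  qed
  then show ?thesis
    by (simp add: weier_def)
qed

lemma weier_sum_deriv: "(weier_sum l p has_real_derivative - (2 * pi * weier_slope l p x)) (at x)"
  unfolding weier_sum_def[abs_def] weier_slope_def
  by (rule derivative_eq_intros refl | simp)+
    (simp add: sum_distrib_left sum_negf[symmetric] power_divide mult_ac)

lemma weier_slope_deriv: "(weier_slope l p has_real_derivative weier_curv l p x) (at x)"
  unfolding weier_slope_def[abs_def] weier_curv_def
  by (rule derivative_eq_intros refl | simp)+
    (simp add: sum_distrib_left power_divide power2_eq_square power_mult_distrib mult_ac)

lemma geometric_sum_le:
  fixes q :: real
  assumes "q > 1"
  shows "(\<Sum>j<p. q ^ j) \<le> q ^ p / (q - 1)"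
proof -
  have "(\<Sum>j<p. q ^ j) = (q ^ p - 1) / (q - 1)"
    using assms by (simp add: geometric_sum)
  also have "\<dots> \<le> q ^ p / (q - 1)"
    using assms by (intro divide_right_mono) auto
  finally show ?thesis .
qed

lemma abs_weier_slope_le:
  assumes "l \<ge> 4"
  shows "\<bar>weier_slope l p x\<bar> \<le> real l ^ p"
proof -
  have "\<bar>weier_slope l p x\<bar> \<le> (\<Sum>j<p. (real l / 2) ^ j)"
    unfolding weier_slope_def
    by (rule order_trans[OF sum_abs]) (auto intro!: sum_mono simp: abs_mult mult_left_le)
  also have "\<dots> \<le> (real l / 2) ^ p / (real l / 2 - 1)"
    using assms by (intro geometric_sum_le) auto
  also have "\<dots> \<le> (real l / 2) ^ p / 1"
    using assms by (intro divide_left_mono) auto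
  also have "\<dots> \<le> real l ^ p"
    by (auto intro: power_mono)
  finally show ?thesis .
qed

text \<open>
The powers of 2 and of \<open>l\<close> in the denominator matter: they make the curvature of a block of
frequencies, seen from the scale just above the block, small against the amplitude at that scale.
\<close>

lemma abs_weier_curv_le:
  assumes "l \<ge> 200"
  shows "\<bar>weier_curv l p x\<bar> \<le> (real l ^ p)\<^sup>2 / (10 * real l * 2 ^ p)"
proof -
  have "\<bar>weier_curv l p x\<bar> \<le> 2 * pi * (\<Sum>j<p. ((real l)\<^sup>2 / 2) ^ j)"
    unfolding weier_curv_def abs_mult
    by (intro mult_mono order_trans[OF sum_abs]) (auto intro!: sum_mono simp: abs_mult mult_left_le)
  also have "\<dots> \<le> 2 * pi * (((real l)\<^sup>2 / 2) ^ p / ((real l)\<^sup>2 / 2 - 1))"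
    using assms power_mono[of 200 "real l" 2] by (intro mult_left_mono geometric_sum_le) auto
  also have "\<dots> \<le> 8 * (((real l)\<^sup>2 / 2) ^ p / (80 * real l))"
  proof (intro mult_mono divide_left_mono)
    have "200 * real l \<le> (real l)\<^sup>2"
      using assms by (simp add: power2_eq_square)
    then show "80 * real l \<le> (real l)\<^sup>2 / 2 - 1"
      using assms by simp
    then show "0 < ((real l)\<^sup>2 / 2 - 1) * (80 * real l)"
      using assms by (intro mult_pos_pos) auto
  qed (use pi_less_4 assms power_mono[of 200 "real l" 2] in auto)
  also have "\<dots> = (real l ^ p)\<^sup>2 / (10 * real l * 2 ^ p)"
    by (simp add: power_divide power_mult[symmetric] mult.commute)
  finally show ?thesis .
qed

section \<open>Anticoncentration of slopes\<close>

lemma half_le_sin: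
  fixes x :: real
  assumes "0 \<le> x" "x \<le> pi / 2"
  shows "x / 2 \<le> sin x"
proof (cases "x \<le> 1")
  case True
  have "\<bar>sin x - (\<Sum>k<3. sin_coeff k * x ^ k)\<bar> \<le> inverse (fact 3) * \<bar>x\<bar> ^ 3"
    by (rule Maclaurin_sin_bound)
  then have "\<bar>sin x - x\<bar> \<le> x ^ 3 / 6"
    using assms by (simp add: sin_coeff_def eval_nat_numeral fact_numeral)
  moreover have "x ^ 3 \<le> x"
    using assms True power_decreasing[of 1 3 x] by simp
  ultimately show ?thesis using assms by linarith
next
  case False
  have "\<bar>sin 1 - (\<Sum>k<3. sin_coeff k * 1 ^ k)\<bar> \<le> inverse (fact 3) * \<bar>1::real\<bar> ^ 3"
    by (rule Maclaurin_sin_bound)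
  then have "\<bar>sin 1 - (1::real)\<bar> \<le> 1 / 6"
    by (simp add: sin_coeff_def eval_nat_numeral fact_numeral)
  moreover have "sin 1 \<le> sin x"
    using False assms by (intro sin_monotone_2pi_le) auto
  moreover have "x \<le> 1.6"
    using assms pi_less_4 pi_approx by simp
  ultimately show ?thesis by linarith
qed

text \<open>
On an arc between two critical points the sine is monotone, and in the worst case, next to a
critical point, its increments are quadratic in the distance.
\<close>

lemma square_le_sin_diff:
  fixes a b :: real
  assumes "\<bar>a\<bar> \<le> pi / 2" "\<bar>b\<bar> \<le> pi / 2"
  shows "(b - a)\<^sup>2 / 8 \<le> \<bar>sin b - sin a\<bar>"
proof -
  have *: "(v - u)\<^sup>2 / 8 \<le> sin v - sin u" if "u \<le> v" "- (pi / 2) \<le> u" "v \<le> pi / 2" for u v :: real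
  proof -
    define d where "d = (v - u) / 2"
    have d: "0 \<le> d" "d \<le> pi / 2"
      using that by (auto simp: d_def)
    have "d / 2 \<le> sin d"
      using d by (rule half_le_sin)
    have "sin d = cos (pi / 2 - d)"
      by (simp add: cos_diff)
    also have "\<dots> \<le> cos \<bar>(v + u) / 2\<bar>"
      using that by (intro cos_monotone_0_pi_le) (auto simp: d_def abs_le_iff field_simps)
    finally have "sin d \<le> cos ((v + u) / 2)"
      unfolding cos_abs_real .
    have "(v - u)\<^sup>2 / 8 = 2 * (d / 2 * (d / 2))"
      by (simp add: d_def power2_eq_square field_simps)
    also have "\<dots> \<le> 2 * (sin d * cos ((v + u) / 2))"
      using d \<open>d / 2 \<le> sin d\<close> \<open>sin d \<le> cos ((v + u) / 2)\<close>
      by (intro mult_left_mono mult_mono) auto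
    also have "\<dots> = sin v - sin u"
      by (simp add: sin_diff_sin d_def)
    finally show ?thesis .
  qed
  show ?thesis
  proof (cases "a \<le> b")
    case True
    then have "(b - a)\<^sup>2 / 8 \<le> sin b - sin a" using assms by (intro *) linarith+
    then show ?thesis by linarith
  next
    case False
    then have "(a - b)\<^sup>2 / 8 \<le> sin a - sin b" using assms by (intro *) linarith+
    then show ?thesis unfolding power2_commute[of b a] by linarith
  qed
qed

lemma card_le_diameter:
  fixes S :: "nat set" and D :: real
  assumes "finite S" and D: "\<And>i j. i \<in> S \<Longrightarrow> j \<in> S \<Longrightarrow> real i - real j \<le> D" and "D \<ge> 0"
  shows "real (card S) \<le> D + 1"
proof (cases "S = {}")
  case False
  have "S \<subseteq> {Min S..Max S}"
    using assms(1) by auto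
  then have "card S \<le> card {Min S..Max S}"
    by (intro card_mono) auto
  moreover have "Min S \<le> Max S"
    using False assms(1) by (meson Max_ge Min_in)
  ultimately have "real (card S) \<le> real (Max S) - real (Min S) + 1"
    by auto
  also have "\<dots> \<le> D + 1"
    using D[of "Max S" "Min S"] False assms(1) by simp
  finally show ?thesis .
qed (use \<open>D \<ge> 0\<close> in simp)

text \<open>
Each of the three arcs \<open>[m \<pi> - \<pi>/2, m \<pi> + \<pi>/2]\<close> contains only few of the equidistant angles
\<open>\<theta> k\<close>: by the quadratic lower bound the indices involved differ by \<open>O(sqrt l)\<close>.
\<close>

lemma card_sin_near_le:
  fixes l :: nat and y s :: real
  assumes l: "l \<ge> 1" and y: "0 \<le> y" "y \<le> 1"
  shows "real (card {k. k < l \<and> \<bar>sin (2 * pi * (real k + y) / real l) - s\<bar> \<le> 5 / real l}) \<le> 9 * sqrt (real l)"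
proof -
  define \<theta> where "\<theta> k = 2 * pi * (real k + y) / real l" for k :: nat
  define S where "S m = {k. k < l \<and> \<bar>\<theta> k - real m * pi\<bar> \<le> pi / 2 \<and> \<bar>sin (\<theta> k) - s\<bar> \<le> 5 / real l}" for m :: nat
  have sq: "1 \<le> sqrt (real l)"
    using l by simp
  have S: "real (card (S m)) \<le> 3 * sqrt (real l)" for m
  proof -
    have "real i - real j \<le> 2 * sqrt (real l)" if "i \<in> S m" "j \<in> S m" for i j
    proof -
      have "(\<theta> i - \<theta> j)\<^sup>2 / 8 \<le> \<bar>sin (\<theta> i - real m * pi) - sin (\<theta> j - real m * pi)\<bar>"
        using square_le_sin_diff[of "\<theta> j - real m * pi" "\<theta> i - real m * pi"] that by (simp add: S_def)
      also have "\<dots> = \<bar>(-1) ^ m * (sin (\<theta> i) - sin (\<theta> j))\<bar>"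
        by (simp add: sin_diff algebra_simps)
      also have "\<dots> = \<bar>sin (\<theta> i) - sin (\<theta> j)\<bar>"
        by (simp add: abs_mult power_abs)
      also have "\<dots> \<le> 10 / real l"
        using that by (auto simp: S_def abs_le_iff)
      finally have "(\<theta> i - \<theta> j)\<^sup>2 \<le> 80 / real l"
        by simp
      moreover have "\<theta> i - \<theta> j = 2 * pi * (real i - real j) / real l"
        using l by (simp add: \<theta>_def field_simps)
      ultimately have "4 * pi\<^sup>2 * (real i - real j)\<^sup>2 / (real l)\<^sup>2 \<le> 80 / real l"
        by (simp add: power_mult_distrib power_divide)
      then have "4 * pi\<^sup>2 * (real i - real j)\<^sup>2 / (real l)\<^sup>2 * (real l)\<^sup>2 \<le> 80 / real l * (real l)\<^sup>2"
        by (rule mult_right_mono) simp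
      then have "4 * pi\<^sup>2 * (real i - real j)\<^sup>2 \<le> 80 * real l"
        using l by (simp add: power2_eq_square)
      moreover have "9 \<le> pi\<^sup>2"
        using power_mono[of 3 pi 2] pi_gt3 by simp
      then have "4 * 9 * (real i - real j)\<^sup>2 \<le> 4 * pi\<^sup>2 * (real i - real j)\<^sup>2"
        by (intro mult_right_mono) auto
      ultimately have "(real i - real j)\<^sup>2 \<le> 2\<^sup>2 * real l"
        by simp
      then have "\<bar>real i - real j\<bar> \<le> sqrt (2\<^sup>2 * real l)"
        using real_le_rsqrt by fastforce
      then show ?thesis
        by (simp add: real_sqrt_mult)
    qed
    then have "real (card (S m)) \<le> 2 * sqrt (real l) + 1"
      by (intro card_le_diameter) (auto simp: S_def)
    then show ?thesis using sq by linarith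
  qed
  have "{k. k < l \<and> \<bar>sin (\<theta> k) - s\<bar> \<le> 5 / real l} \<subseteq> S 0 \<union> S 1 \<union> S 2"
  proof
    fix k assume k: "k \<in> {k. k < l \<and> \<bar>sin (\<theta> k) - s\<bar> \<le> 5 / real l}"
    then have "real k + y \<le> real l"
      using y by (simp flip: of_nat_Suc add: Suc_le_eq)
    then have "2 * pi * (real k + y) \<le> 2 * pi * real l"
      by (intro mult_left_mono) auto
    then have "\<theta> k \<le> 2 * pi"
      using l by (simp add: \<theta>_def divide_le_eq)
    moreover have "0 \<le> \<theta> k"
      using y by (simp add: \<theta>_def)
    ultimately have "\<bar>\<theta> k\<bar> \<le> pi / 2 \<or> \<bar>\<theta> k - pi\<bar> \<le> pi / 2 \<or> \<bar>\<theta> k - 2 * pi\<bar> \<le> pi / 2"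
      by linarith
    then show "k \<in> S 0 \<union> S 1 \<union> S 2"
      using k by (auto simp: S_def)
  qed
  then have "card {k. k < l \<and> \<bar>sin (\<theta> k) - s\<bar> \<le> 5 / real l} \<le> card (S 0 \<union> S 1 \<union> S 2)"
    by (intro card_mono) (auto simp: S_def)
  also have "\<dots> \<le> card (S 0) + card (S 1) + card (S 2)"
    by (meson add_le_mono1 card_Un_le order_trans)
  finally show ?thesis
    using S[of 0] S[of 1] S[of 2] unfolding \<theta>_def by linarith
qed

text \<open>
Write \<open>k\<close> in base \<open>l\<close>. The term of highest frequency depends on the last digit \<open>d\<close> of \<open>k\<close> only and
dominates the sum of all the others by a factor of order \<open>l\<close>. A value near \<open>s\<close> therefore forces the
sine in that term into a window of width \<open>O(1/l)\<close>, which leaves \<open>O(sqrt l)\<close> of the \<open>l\<close> digits. Once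
\<open>d\<close> is fixed, the remaining digits face the same problem with \<open>p\<close> terms and another target \<open>s'\<close>.
Thus the proportion of slopes near any given value is at most \<open>(9 / sqrt l) ^ p\<close>.
\<close>

lemma card_weier_slope_near_le:
  fixes l :: nat and y s :: real
  assumes l: "l \<ge> 8" and "0 \<le> y" "y \<le> 1"
  shows "real (card {k. k < l ^ p \<and> \<bar>weier_slope l p ((real k + y) / real l ^ p) - s\<bar> \<le> 1 / real l})
     \<le> (9 * sqrt (real l)) ^ p"
  using assms(2,3)
proof (induction p arbitrary: y s)
  case 0
  have "card {k. k = (0::nat) \<and> \<bar>weier_slope l 0 (real k + y) - s\<bar> \<le> 1 / real l} \<le> card {0::nat}"
    by (intro card_mono) auto
  then show ?case by simp
next
  case (Suc p)
  define q where "q = real l / 2"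
  have q: "q \<ge> 4"
    using l by (simp add: q_def)
  define B where "B = {k. k < l ^ Suc p \<and> \<bar>weier_slope l (Suc p) ((real k + y) / real l ^ Suc p) - s\<bar> \<le> 1 / real l}"
  define K where "K = {d. d < l \<and> \<bar>sin (2 * pi * (real d + y) / real l) - s / q ^ p\<bar> \<le> 5 / real l}"
  define y' where "y' d = (real d + y) / real l" for d :: nat
  define s' where "s' d = s - q ^ p * sin (2 * pi * (real d + y) / real l)" for d :: nat
  define C where "C d = {k. k < l ^ p \<and> \<bar>weier_slope l p ((real k + y' d) / real l ^ p) - s' d\<bar> \<le> 1 / real l}" for d
  have "B \<subseteq> (\<lambda>(d, k). d + l * k) ` (SIGMA d:K. C d)"
  proof
    fix k assume k: "k \<in> B"
    define d where "d = k mod l"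
    define m where "m = k div l"
    have km: "k = d + l * m"
      by (simp add: d_def m_def)
    have d: "d < l"
      using l by (simp add: d_def)
    have m: "m < l ^ p"
      using k l by (simp add: m_def B_def less_mult_imp_div_less mult.commute)
    have x: "(real k + y) / real l ^ Suc p = (real m + y' d) / real l ^ p"
      using l by (simp add: km y'_def field_simps)
    have top: "sin (2 * pi * real l ^ p * ((real k + y) / real l ^ Suc p)) = sin (2 * pi * (real d + y) / real l)"
    proof -
      have "2 * pi * real l ^ p * ((real k + y) / real l ^ Suc p) = 2 * pi * (real d + y) / real l + 2 * real m * pi"
        using l by (simp add: km field_simps)
      then show ?thesis
        by (simp only: sin_add sin_2npi cos_2npi mult_1_right mult_zero_right add_0_right)
    qed
    have split: "weier_slope l (Suc p) ((real k + y) / real l ^ Suc p) =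
        weier_slope l p ((real m + y' d) / real l ^ p) + q ^ p * sin (2 * pi * (real d + y) / real l)"
      unfolding x[symmetric] weier_slope_def sum.lessThan_Suc top q_def ..
    have near: "\<bar>weier_slope l p ((real m + y' d) / real l ^ p) - s' d\<bar> \<le> 1 / real l"
      using k unfolding B_def mem_Collect_eq split s'_def by (simp add: algebra_simps)
    have qp: "q ^ p > 0" "1 \<le> q ^ p"
      using q by (auto intro: one_le_power)
    have "\<bar>weier_slope l p ((real m + y' d) / real l ^ p)\<bar> \<le> (\<Sum>j<p. q ^ j)"
      unfolding weier_slope_def q_def
      by (rule order_trans[OF sum_abs]) (auto intro!: sum_mono simp: abs_mult mult_left_le)
    also have "\<dots> \<le> q ^ p / (q - 1)"
      using q by (intro geometric_sum_le) auto
    also have "\<dots> \<le> q ^ p / (q / 2)"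
      using q qp by (intro divide_left_mono) auto
    also have "\<dots> = q ^ p * (4 / real l)"
      using l by (simp add: q_def)
    finally have tail: "\<bar>weier_slope l p ((real m + y' d) / real l ^ p)\<bar> \<le> q ^ p * (4 / real l)" .
    have "1 / real l \<le> q ^ p * (1 / real l)"
      using qp l by (simp add: divide_right_mono)
    then have "\<bar>s' d\<bar> \<le> q ^ p * (4 / real l) + q ^ p * (1 / real l)"
      using near tail by linarith
    also have "\<dots> = q ^ p * (5 / real l)"
      by (simp add: field_simps)
    finally have "\<bar>s' d / q ^ p\<bar> \<le> 5 / real l"
      using qp by (simp add: abs_divide field_simps)
    moreover have "s' d / q ^ p = - (sin (2 * pi * (real d + y) / real l) - s / q ^ p)"
      using q by (simp add: s'_def diff_divide_distrib)
    ultimately have "d \<in> K"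
      using d by (simp add: K_def)
    moreover have "m \<in> C d"
      using m near by (simp add: C_def)
    ultimately show "k \<in> (\<lambda>(d, k). d + l * k) ` (SIGMA d:K. C d)"
      using km by force
  qed
  moreover have fin: "finite K" "\<And>d. finite (C d)"
    by (auto simp: K_def C_def)
  ultimately have "card B \<le> card (SIGMA d:K. C d)"
    by (meson card_image_le card_mono finite_SigmaI finite_imageI order_trans)
  then have "real (card B) \<le> (\<Sum>d\<in>K. real (card (C d)))"
    using fin by (simp flip: of_nat_sum)
  also have "\<dots> \<le> (\<Sum>d\<in>K. (9 * sqrt (real l)) ^ p)"
  proof (rule sum_mono)
    fix d assume "d \<in> K"
    then have "real d + y \<le> real l"
      using Suc.prems by (simp add: K_def flip: of_nat_Suc add: Suc_le_eq)
    then have "0 \<le> y' d" "y' d \<le> 1"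
      using Suc.prems l by (auto simp: y'_def)
    then show "real (card (C d)) \<le> (9 * sqrt (real l)) ^ p"
      unfolding C_def by (rule Suc.IH)
  qed
  also have "\<dots> = real (card K) * (9 * sqrt (real l)) ^ p"
    by simp
  also have "\<dots> \<le> (9 * sqrt (real l)) * (9 * sqrt (real l)) ^ p"
    unfolding K_def using l Suc.prems by (intro mult_right_mono card_sin_near_le) auto
  finally show ?case
    by (simp add: B_def)
qed

section \<open>Folding slowly modulated waves\<close>

text \<open>
The class of perturbations that reproduces itself under the renormalisation step. Only the second
derivative of \<open>M\<close> is controlled, so arbitrary linear phases are included; this makes all later
bounds uniform in the Fourier frequency.
\<close>

definition slowly_modulated :: "real \<Rightarrow> (real \<Rightarrow> complex) \<Rightarrow> (real \<Rightarrow> real) \<Rightarrow> bool" where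
  "slowly_modulated K a M \<longleftrightarrow> (\<exists>a' M' M''.
     (\<forall>x. (a has_vector_derivative a' x) (at x)) \<and>
     (\<forall>x. (M has_real_derivative M' x) (at x)) \<and>
     (\<forall>x. (M' has_real_derivative M'' x) (at x)) \<and>
     (\<forall>x\<in>{0..1}. norm (a x) \<le> 1 \<and> norm (a' x) \<le> 1 \<and> \<bar>M'' x\<bar> \<le> K))"

definition osc_bound :: "nat \<Rightarrow> real \<Rightarrow> real \<Rightarrow> bool" where
  "osc_bound l T B \<longleftrightarrow> (\<forall>a M. slowly_modulated (T / real l) a M \<longrightarrow>
     norm (integral {0..1} (\<lambda>x. a x * cis (M x + T * weier l x))) \<le> B)"

text \<open>
One integral of the class, together with the number \<open>p\<close> of frequencies that are folded away. The
lower bound on \<open>T\<close> makes the oscillation of these \<open>p\<close> frequencies dominate every error that is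
polynomial in \<open>l\<^sup>p\<close>.
\<close>

locale slow_modulation =
  fixes l p :: nat and T :: real
    and a a' :: "real \<Rightarrow> complex" and M M' M'' :: "real \<Rightarrow> real"
  assumes l: "l \<ge> 200" and p: "p \<ge> 1" and T: "real l ^ (8 * p) \<le> T"
    and a_deriv: "\<And>x. (a has_vector_derivative a' x) (at x)"
    and M_deriv: "\<And>x. (M has_real_derivative M' x) (at x)"
    and M'_deriv: "\<And>x. (M' has_real_derivative M'' x) (at x)"
    and a_le: "\<And>x. x \<in> {0..1} \<Longrightarrow> norm (a x) \<le> 1"
    and a'_le: "\<And>x. x \<in> {0..1} \<Longrightarrow> norm (a' x) \<le> 1"
    and M''_le: "\<And>x. x \<in> {0..1} \<Longrightarrow> \<bar>M'' x\<bar> \<le> T / real l"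
begin

abbreviation \<Lambda> :: real where "\<Lambda> \<equiv> real l ^ p"

abbreviation branch :: "nat \<Rightarrow> real \<Rightarrow> real" where "branch \<equiv> cell l p"

text \<open>
The phase on the \<open>k\<close>-th branch, without the frequencies from \<open>l\<^sup>p\<close> on and without the linear term
\<open>M' 0 * y / \<Lambda>\<close>. Both are the same on all branches and can be factored out of the sum over \<open>k\<close>; what
remains has derivative \<open>O(T)\<close>, however large \<open>M' 0\<close> is.
\<close>

definition branch_phase :: "nat \<Rightarrow> real \<Rightarrow> real" where
  "branch_phase k y = M (branch k y) - M' 0 * y / \<Lambda> + T * weier_sum l p (branch k y)"

definition branch_phase' :: "nat \<Rightarrow> real \<Rightarrow> real" where
  "branch_phase' k y = (M' (branch k y) - M' 0 - 2 * pi * T * weier_slope l p (branch k y)) / \<Lambda>"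

definition branch_phase'' :: "nat \<Rightarrow> real \<Rightarrow> real" where
  "branch_phase'' k y = (M'' (branch k y) - 2 * pi * T * weier_curv l p (branch k y)) / \<Lambda>\<^sup>2"

definition wave :: "nat \<Rightarrow> real \<Rightarrow> complex" where
  "wave k y = a (branch k y) * cis (branch_phase k y)"

lemma \<Lambda>_ge: "real l \<le> \<Lambda>"
  using power_increasing[of 1 p "real l"] l p by simp

lemma \<Lambda>_pos: "\<Lambda> > 0"
  using l by simp

lemma T_ge: "\<Lambda> ^ 8 \<le> T"
  using T by (simp add: power_mult[symmetric] mult.commute)

lemma T_ge_1: "1 \<le> T"
  using T_ge one_le_power[of \<Lambda> 8] \<Lambda>_ge l by linarith

lemma branch_deriv: "(branch k has_real_derivative 1 / \<Lambda>) (at y)"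
  using l by (intro cell_deriv) simp

lemmas branch_in = cell_in[of _ l p]

lemma branch_phase_deriv: "(branch_phase k has_real_derivative branch_phase' k y) (at y)"
proof -
  have "(branch_phase k has_real_derivative
      M' (branch k y) * (1 / \<Lambda>) - M' 0 / \<Lambda> + T * (- (2 * pi * weier_slope l p (branch k y)) * (1 / \<Lambda>))) (at y)"
    unfolding branch_phase_def[abs_def]
    by (intro DERIV_add DERIV_diff DERIV_cdivide DERIV_cmult DERIV_cmult_Id
        DERIV_chain2[OF M_deriv branch_deriv] DERIV_chain2[OF weier_sum_deriv branch_deriv])
  then show ?thesis
    unfolding branch_phase'_def using \<Lambda>_pos by (simp add: field_simps)
qed

lemma branch_phase'_deriv: "(branch_phase' k has_real_derivative branch_phase'' k y) (at y)"
proof -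
  have "(branch_phase' k has_real_derivative
      (M'' (branch k y) * (1 / \<Lambda>) - 0 - 2 * pi * T * (weier_curv l p (branch k y) * (1 / \<Lambda>))) / \<Lambda>) (at y)"
    unfolding branch_phase'_def[abs_def]
    by (intro DERIV_diff DERIV_cdivide DERIV_cmult DERIV_const
        DERIV_chain2[OF M'_deriv branch_deriv] DERIV_chain2[OF weier_slope_deriv branch_deriv])
  then show ?thesis
    unfolding branch_phase''_def using \<Lambda>_pos by (simp add: field_simps power2_eq_square)
qed

lemma amp_deriv: "((\<lambda>y. a (branch k y)) has_vector_derivative a' (branch k y) / of_real \<Lambda>) (at y)"
proof -
  have "(branch k has_vector_derivative 1 / \<Lambda>) (at y)"
    using branch_deriv has_real_derivative_iff_has_vector_derivative by blast
  from vector_diff_chain_at[OF this a_deriv] show ?thesis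
    by (simp add: o_def scaleR_conv_of_real divide_simps)
qed

lemma M'_osc:
  assumes "x \<in> {0..1}"
  shows "\<bar>M' x - M' 0\<bar> \<le> T / real l"
proof (cases "x = 0")
  case True
  then show ?thesis using T_ge_1 by simp
next
  case False
  then have "0 < x" using assms by simp
  then obtain z where z: "z > 0" "z < x" "M' x - M' 0 = (x - 0) * M'' z"
    using MVT2[of 0 x M' M''] M'_deriv by blast
  then have "\<bar>M' x - M' 0\<bar> = x * \<bar>M'' z\<bar>"
    using \<open>0 < x\<close> by (simp add: abs_mult)
  also have "\<dots> \<le> 1 * (T / real l)"
    using z assms by (intro mult_mono M''_le) auto
  finally show ?thesis by simp
qed

lemma T_div_l: "T / real l \<le> T"
  using T_ge_1 l by (simp add: field_simps)

lemma branch_phase'_le: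
  assumes "k < l ^ p" "y \<in> {0..1}"
  shows "\<bar>branch_phase' k y\<bar> \<le> 9 * T"
proof -
  have "\<bar>2 * pi * T * weier_slope l p (branch k y)\<bar> \<le> 2 * 4 * T * \<Lambda>"
    unfolding abs_mult using T_ge_1 pi_less_4 l by (intro mult_mono abs_weier_slope_le) auto
  moreover have "\<bar>M' (branch k y) - M' 0\<bar> \<le> T"
    using M'_osc[OF branch_in[OF assms]] T_div_l by linarith
  moreover have "T * 1 \<le> T * \<Lambda>"
    using T_ge_1 \<Lambda>_ge l by (intro mult_left_mono) auto
  ultimately have "\<bar>M' (branch k y) - M' 0 - 2 * pi * T * weier_slope l p (branch k y)\<bar> \<le> 9 * T * \<Lambda>"
    by linarith
  then show ?thesis
    unfolding branch_phase'_def abs_divide using \<Lambda>_pos by (simp add: field_simps)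
qed

lemma branch_phase''_le:
  assumes "k < l ^ p" "y \<in> {0..1}"
  shows "\<bar>branch_phase'' k y\<bar> \<le> 5 * T"
proof -
  have "\<bar>weier_curv l p (branch k y)\<bar> \<le> \<Lambda>\<^sup>2 / (10 * real l * 2 ^ p)"
    using l by (rule abs_weier_curv_le)
  also have "\<dots> \<le> \<Lambda>\<^sup>2 / 2"
  proof (intro divide_left_mono)
    show "2 \<le> 10 * real l * 2 ^ p"
      using l one_le_power[of "2::real" p] mult_mono[of 2 "10 * real l" 1 "2 ^ p"] by simp
  qed (use l in auto)
  finally have "\<bar>2 * pi * T * weier_curv l p (branch k y)\<bar> \<le> 2 * 4 * T * (\<Lambda>\<^sup>2 / 2)"
    unfolding abs_mult using T_ge_1 pi_less_4 by (intro mult_mono) auto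
  moreover have "\<bar>M'' (branch k y)\<bar> \<le> T"
    using M''_le[OF branch_in[OF assms]] T_div_l by linarith
  moreover have "T * 1 \<le> T * \<Lambda>\<^sup>2"
    using T_ge_1 \<Lambda>_ge l by (intro mult_left_mono) (auto intro: one_le_power)
  ultimately have "\<bar>M'' (branch k y) - 2 * pi * T * weier_curv l p (branch k y)\<bar> \<le> 5 * T * \<Lambda>\<^sup>2"
    by linarith
  then show ?thesis
    unfolding branch_phase''_def abs_divide using \<Lambda>_pos by (simp add: field_simps)
qed

lemma continuous_on_branch_phase: "continuous_on S (branch_phase k)"
  using branch_phase_deriv by (meson DERIV_continuous continuous_at_imp_continuous_on)

lemma continuous_on_branch_phase': "continuous_on S (branch_phase' k)"
  using branch_phase'_deriv by (meson DERIV_continuous continuous_at_imp_continuous_on)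

lemma continuous_on_wave: "continuous_on S (wave k)"
proof -
  have "continuous_on S (\<lambda>y. a (branch k y))"
    by (rule continuous_at_imp_continuous_on) (use amp_deriv has_vector_derivative_continuous in blast)
  then show ?thesis
    unfolding wave_def[abs_def] by (intro continuous_intros continuous_on_branch_phase)
qed

text \<open>
The frequency below which two branches count as resonant. It is \<open>1 / \<Lambda>\<close> times the frequency gap
\<open>T / (l \<Lambda>)\<close> that the counting lemma can resolve, so that a pair with at least this gap has resonance
at most \<open>1 / \<Lambda>\<^sup>2\<close>.
\<close>

definition \<epsilon> :: real where "\<epsilon> = T / (real l * \<Lambda>\<^sup>2)"

text \<open>
The proportion of the pair of branches \<open>k\<close>, \<open>m\<close> that escapes integration by parts at the point \<open>y\<close>.
\<close>

definition resonance :: "nat \<Rightarrow> nat \<Rightarrow> real \<Rightarrow> real" where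
  "resonance k m y = \<epsilon>\<^sup>2 / (\<epsilon>\<^sup>2 + (branch_phase' k y - branch_phase' m y)\<^sup>2)"

lemma \<epsilon>_pos: "\<epsilon> > 0"
  using T_ge_1 l by (simp add: \<epsilon>_def)

text \<open>
By the lower bound \<open>\<Lambda> ^ 8 \<le> T\<close> the boundary and curvature terms of the integration by parts are
negligible, and only the resonance is left.
\<close>

lemma pair_integral_le:
  assumes "k < l ^ p" "m < l ^ p"
  shows "norm (integral {0..1} (\<lambda>y. wave k y * cnj (wave m y)))
    \<le> 12 / \<Lambda>\<^sup>2 + integral {0..1} (resonance k m)"
proof -
  define c where "c y = a (branch k y) * cnj (a (branch m y))" for y
  define c' where "c' y = a (branch k y) * cnj (a' (branch m y) / of_real \<Lambda>) + a' (branch k y) / of_real \<Lambda> * cnj (a (branch m y))" for y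
  have dc: "(c has_vector_derivative c' y) (at y)" for y
    unfolding c_def[abs_def] c'_def
    by (intro has_vector_derivative_mult amp_deriv has_vector_derivative_cnj)
  have small: "norm (a' (branch j y) / of_real \<Lambda>) \<le> 1" if "j < l ^ p" "y \<in> {0..1}" for j y
  proof -
    have "norm (a' (branch j y)) \<le> \<Lambda>"
      using a'_le[OF branch_in[OF that]] \<Lambda>_ge l by linarith
    then show ?thesis
      using \<Lambda>_pos by (simp add: norm_divide norm_power)
  qed
  have "norm (integral {0..1} (\<lambda>y. c y * cis (branch_phase k y - branch_phase m y)))
    \<le> 2 / \<epsilon> + 10 * T / \<epsilon>\<^sup>2 + integral {0..1} (\<lambda>y. \<epsilon>\<^sup>2 / (\<epsilon>\<^sup>2 + (branch_phase' k y - branch_phase' m y)\<^sup>2))"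
  proof (rule oscillatory_integral_le[OF dc _ _ _ _ _ \<epsilon>_pos])
    fix y :: real
    show "((\<lambda>y. branch_phase k y - branch_phase m y) has_real_derivative branch_phase' k y - branch_phase' m y) (at y)"
      by (intro DERIV_diff branch_phase_deriv)
    show "((\<lambda>y. branch_phase' k y - branch_phase' m y) has_real_derivative branch_phase'' k y - branch_phase'' m y) (at y)"
      by (intro DERIV_diff branch_phase'_deriv)
    assume y: "y \<in> {0..1}"
    show "norm (c y) \<le> 1"
      unfolding c_def norm_mult complex_mod_cnj
      using a_le[OF branch_in[OF assms(1) y]] a_le[OF branch_in[OF assms(2) y]] by (simp add: mult_le_one)
    have "norm (c' y) \<le> 1 * 1 + 1 * 1"
      unfolding c'_def
      using a_le[OF branch_in[OF assms(1) y]] a_le[OF branch_in[OF assms(2) y]] small[OF assms(1) y] small[OF assms(2) y]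
      by (intro norm_triangle_le add_mono) (simp_all only: norm_mult complex_mod_cnj, auto intro: mult_le_one)
    then show "norm (c' y) \<le> 2" by simp
    show "\<bar>branch_phase'' k y - branch_phase'' m y\<bar> \<le> 10 * T"
      using branch_phase''_le[OF assms(1) y] branch_phase''_le[OF assms(2) y] by linarith
  qed
  moreover have "c y * cis (branch_phase k y - branch_phase m y) = wave k y * cnj (wave m y)" for y
    by (simp add: c_def wave_def cis_cnj cis_divide[symmetric] divide_inverse flip: cis_mult)
  moreover have "2 / \<epsilon> + 10 * T / \<epsilon>\<^sup>2 \<le> 12 / \<Lambda>\<^sup>2"
  proof -
    have "2 / \<epsilon> \<le> 2 / \<Lambda>\<^sup>2"
    proof (rule divide_left_mono)
      have "\<Lambda>\<^sup>2 * (real l * \<Lambda>\<^sup>2) \<le> \<Lambda>\<^sup>2 * (\<Lambda> * \<Lambda>\<^sup>2)"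
        using \<Lambda>_ge \<Lambda>_pos by (intro mult_left_mono mult_right_mono) auto
      also have "\<dots> = \<Lambda> ^ 5"
        by (simp add: eval_nat_numeral)
      also have "\<dots> \<le> \<Lambda> ^ 8"
        using \<Lambda>_ge l by (intro power_increasing) auto
      also have "\<dots> \<le> T" by (rule T_ge)
      finally show "\<Lambda>\<^sup>2 \<le> \<epsilon>"
        unfolding \<epsilon>_def using l by (simp add: field_simps)
    qed (use \<epsilon>_pos \<Lambda>_pos in auto)
    moreover have "10 * T / \<epsilon>\<^sup>2 \<le> 10 / \<Lambda>\<^sup>2"
    proof -
      have "10 * T / \<epsilon>\<^sup>2 = 10 * ((real l)\<^sup>2 * \<Lambda> ^ 4) / T"
        unfolding \<epsilon>_def using T_ge_1 by (simp add: power_divide power_mult_distrib power2_eq_square field_simps eval_nat_numeral)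
      also have "\<dots> \<le> 10 * (\<Lambda>\<^sup>2 * \<Lambda> ^ 4) / T"
        using \<Lambda>_ge T_ge_1 by (intro divide_right_mono mult_left_mono mult_right_mono power_mono) auto
      also have "\<dots> \<le> 10 * (\<Lambda>\<^sup>2 * \<Lambda> ^ 4) / \<Lambda> ^ 8"
        using T_ge T_ge_1 \<Lambda>_pos by (intro divide_left_mono) auto
      also have "\<dots> = 10 / \<Lambda>\<^sup>2"
        using \<Lambda>_pos by (simp add: eval_nat_numeral field_simps)
      finally show ?thesis .
    qed
    ultimately show ?thesis by simp
  qed
  ultimately show ?thesis
    unfolding resonance_def[abs_def] by simp
qed

text \<open>
For a fixed branch \<open>m\<close>, few branches have nearly the same slope as \<open>m\<close>; the contribution of \<open>M'\<close> to
the slopes varies by no more than the width of the counting window and only shifts the target.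
\<close>

lemma sum_resonance_le:
  assumes m: "m < l ^ p" and y: "y \<in> {0..1}"
  shows "(\<Sum>k<l ^ p. resonance k m y) \<le> (9 * sqrt (real l)) ^ p + 1 / \<Lambda>"
proof -
  define s where "s = (- \<Lambda> * branch_phase' m y) / (2 * pi * T)"
  define B where "B = {k. k < l ^ p \<and> \<bar>weier_slope l p ((real k + y) / \<Lambda>) - s\<bar> \<le> 1 / real l}"
  have w: "resonance k m y \<le> (if k \<in> B then 1 else 0) + 1 / \<Lambda>\<^sup>2" if k: "k < l ^ p" for k
  proof (cases "k \<in> B")
    case True
    have "resonance k m y \<le> 1"
      unfolding resonance_def using \<epsilon>_pos by (intro divide_le_eq_1_pos[THEN iffD2] add_pos_nonneg) auto
    then show ?thesis using True \<Lambda>_pos by (simp add: add_increasing2)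
  next
    case False
    \<comment> \<open>outside \<open>B\<close> the slopes of \<open>k\<close> and \<open>m\<close> differ by at least \<open>\<epsilon> * \<Lambda>\<close>\<close>
    have eq: "2 * pi * T * (weier_slope l p (branch k y) - s) = (M' (branch k y) - M' 0) - \<Lambda> * (branch_phase' k y - branch_phase' m y)"
    proof -
      have "\<Lambda> * branch_phase' k y = M' (branch k y) - M' 0 - 2 * pi * T * weier_slope l p (branch k y)"
        unfolding branch_phase'_def using \<Lambda>_pos by simp
      moreover have "2 * pi * T * s = - (\<Lambda> * branch_phase' m y)"
        unfolding s_def using T_ge_1 by simp
      ultimately show ?thesis by (simp add: algebra_simps)
    qed
    have "1 / real l < \<bar>weier_slope l p (branch k y) - s\<bar>"
      using False k by (simp add: B_def cell_def)
    then have "T * (1 / real l) \<le> T * \<bar>weier_slope l p (branch k y) - s\<bar>"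
      using T_ge_1 by (intro mult_left_mono) auto
    moreover have "1 * (T * \<bar>weier_slope l p (branch k y) - s\<bar>) \<le> pi * (T * \<bar>weier_slope l p (branch k y) - s\<bar>)"
      using T_ge_1 pi_gt3 by (intro mult_right_mono) auto
    ultimately have "2 * T * (1 / real l) \<le> 2 * pi * T * \<bar>weier_slope l p (branch k y) - s\<bar>"
      by linarith
    also have "\<dots> = \<bar>2 * pi * T * (weier_slope l p (branch k y) - s)\<bar>"
      using T_ge_1 by (simp add: abs_mult)
    also have "\<dots> \<le> T / real l + \<bar>\<Lambda> * (branch_phase' k y - branch_phase' m y)\<bar>"
      unfolding eq using M'_osc[OF branch_in[OF k y]] by linarith
    finally have "T / real l \<le> \<Lambda> * \<bar>branch_phase' k y - branch_phase' m y\<bar>"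
      using \<Lambda>_pos by (simp add: abs_mult)
    then have "\<epsilon> * \<Lambda> \<le> \<bar>branch_phase' k y - branch_phase' m y\<bar>"
      unfolding \<epsilon>_def using \<Lambda>_pos l by (simp add: field_simps power2_eq_square)
    then have "(\<epsilon> * \<Lambda>)\<^sup>2 \<le> (branch_phase' k y - branch_phase' m y)\<^sup>2"
      using power_mono[of "\<epsilon> * \<Lambda>" "\<bar>branch_phase' k y - branch_phase' m y\<bar>" 2] \<epsilon>_pos \<Lambda>_pos by simp
    then have "resonance k m y \<le> \<epsilon>\<^sup>2 / (\<epsilon> * \<Lambda>)\<^sup>2"
      unfolding resonance_def using \<epsilon>_pos \<Lambda>_pos
      by (intro divide_left_mono mult_pos_pos add_pos_nonneg) (auto intro: add_increasing)
    also have "\<dots> = 1 / \<Lambda>\<^sup>2"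
      using \<epsilon>_pos by (simp add: power_mult_distrib)
    finally show ?thesis using False by simp
  qed
  have "(\<Sum>k<l ^ p. resonance k m y) \<le> (\<Sum>k<l ^ p. (if k \<in> B then 1 else 0) + 1 / \<Lambda>\<^sup>2)"
    by (intro sum_mono w) auto
  also have "\<dots> = (\<Sum>k<l ^ p. if k \<in> B then 1 else 0) + \<Lambda> * (1 / \<Lambda>\<^sup>2)"
    by (simp add: sum.distrib)
  also have "(\<Sum>k<l ^ p. if k \<in> B then 1 else (0::real)) = real (card ({..<l ^ p} \<inter> B))"
    by (simp add: sum.If_cases)
  also have "{..<l ^ p} \<inter> B = B"
    by (auto simp: B_def)
  also have "real (card B) \<le> (9 * sqrt (real l)) ^ p"
    unfolding B_def using l y by (intro card_weier_slope_near_le) auto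
  also have "\<Lambda> * (1 / \<Lambda>\<^sup>2) = 1 / \<Lambda>"
    using \<Lambda>_pos by (simp add: power2_eq_square)
  finally show ?thesis by simp
qed

definition avg :: "real \<Rightarrow> complex" where
  "avg y = (\<Sum>k<l ^ p. wave k y) /\<^sub>R \<Lambda>"

lemma continuous_on_avg: "continuous_on S avg"
  unfolding avg_def[abs_def] by (intro continuous_intros continuous_on_wave)

text \<open>
This is the gain of the step. Expanding the square gives a double sum over pairs of branches, and
averaging the resonance over one branch while the other is fixed gives the anticoncentration bound.
\<close>

lemma integral_avg_square_le: "integral {0..1} (\<lambda>y. (norm (avg y))\<^sup>2) \<le> (18 / sqrt (real l)) ^ p"
proof -
  define X where "X = integral {0..1} (\<lambda>y. (norm (\<Sum>k<l ^ p. wave k y))\<^sup>2)"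
  have intX: "(\<lambda>y. (norm (\<Sum>k<l ^ p. wave k y))\<^sup>2) integrable_on {0..1}"
    by (intro integrable_continuous_interval continuous_intros continuous_on_wave)
  have cnj_cont: "continuous_on {0..1} (\<lambda>y. wave k y * cnj (wave m y))" for k m
    by (intro continuous_intros continuous_on_wave)
  have res_int: "resonance k m integrable_on {0..1}" for k m
    unfolding resonance_def[abs_def]
    by (intro integrable_continuous_interval continuous_intros continuous_on_branch_phase')
      (use \<epsilon>_pos in \<open>auto simp: sum_power2_eq_zero_iff\<close>)
  have "complex_of_real X = integral {0..1} (\<lambda>y. complex_of_real ((norm (\<Sum>k<l ^ p. wave k y))\<^sup>2))"
    unfolding X_def using integral_linear[OF intX bounded_linear_of_real[where 'a = complex]]
    by (simp add: o_def)
  also have "\<dots> = integral {0..1} (\<lambda>y. \<Sum>m<l ^ p. \<Sum>k<l ^ p. wave k y * cnj (wave m y))"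
  proof -
    have "complex_of_real ((norm (\<Sum>k<l ^ p. wave k y))\<^sup>2) = (\<Sum>m<l ^ p. \<Sum>k<l ^ p. wave k y * cnj (wave m y))" for y
      unfolding complex_norm_square cnj_sum sum_product by (rule sum.swap)
    then show ?thesis by simp
  qed
  also have "\<dots> = (\<Sum>m<l ^ p. \<Sum>k<l ^ p. integral {0..1} (\<lambda>y. wave k y * cnj (wave m y)))"
    by (simp add: integral_sum integrable_sum integrable_continuous_interval cnj_cont)
  finally have "\<bar>X\<bar> = norm (\<Sum>m<l ^ p. \<Sum>k<l ^ p. integral {0..1} (\<lambda>y. wave k y * cnj (wave m y)))"
    by (metis norm_of_real)
  then have "X \<le> norm (\<Sum>m<l ^ p. \<Sum>k<l ^ p. integral {0..1} (\<lambda>y. wave k y * cnj (wave m y)))"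
    by linarith
  also have "\<dots> \<le> (\<Sum>m<l ^ p. \<Sum>k<l ^ p. 12 / \<Lambda>\<^sup>2 + integral {0..1} (resonance k m))"
    by (intro sum_norm_le pair_integral_le) auto
  also have "\<dots> = (\<Sum>m<l ^ p. 12 / \<Lambda> + integral {0..1} (\<lambda>y. \<Sum>k<l ^ p. resonance k m y))"
    using \<Lambda>_pos by (intro sum.cong refl) (simp add: sum.distrib integral_sum res_int power2_eq_square)
  also have "\<dots> \<le> (\<Sum>m<l ^ p. 12 / \<Lambda> + ((9 * sqrt (real l)) ^ p + 1 / \<Lambda>))"
  proof (intro sum_mono add_left_mono)
    fix m assume m: "m \<in> {..<l ^ p}"
    have "integral {0..1} (\<lambda>y. \<Sum>k<l ^ p. resonance k m y) \<le> integral {0..1} (\<lambda>y::real. (9 * sqrt (real l)) ^ p + 1 / \<Lambda>)"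
      by (intro integral_le integrable_sum res_int) (use m sum_resonance_le in auto)
    then show "integral {0..1} (\<lambda>y. \<Sum>k<l ^ p. resonance k m y) \<le> (9 * sqrt (real l)) ^ p + 1 / \<Lambda>"
      by simp
  qed
  also have "\<dots> = 13 + \<Lambda> * (9 * sqrt (real l)) ^ p"
    using \<Lambda>_pos by (simp add: field_simps)
  finally have X: "X \<le> 13 + \<Lambda> * (9 * sqrt (real l)) ^ p" .
  have "integral {0..1} (\<lambda>y. (norm (avg y))\<^sup>2) = X / \<Lambda>\<^sup>2"
    unfolding X_def avg_def
    by (simp add: power_mult_distrib divide_inverse mult.commute[of _ "inverse _"] power_inverse norm_power)
  also have "\<dots> \<le> (13 + \<Lambda> * (9 * sqrt (real l)) ^ p) / \<Lambda>\<^sup>2"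
    using X by (intro divide_right_mono) auto
  also have "\<dots> = 13 / \<Lambda>\<^sup>2 + (9 * sqrt (real l)) ^ p / \<Lambda>"
    using \<Lambda>_pos by (simp add: power2_eq_square add_divide_distrib)
  also have "(9 * sqrt (real l)) ^ p / \<Lambda> = (9 / sqrt (real l)) ^ p"
  proof -
    have "9 * sqrt (real l) / real l = 9 / sqrt (real l)"
      by (metis of_nat_0_le_iff real_div_sqrt times_divide_eq_right divide_divide_eq_right mult.commute)
    then show ?thesis
      by (metis power_divide)
  qed
  also have "13 / \<Lambda>\<^sup>2 \<le> (9 / sqrt (real l)) ^ p"
  proof -
    have "13 \<le> \<Lambda>"
      using \<Lambda>_ge l by linarith
    then have "13 / \<Lambda>\<^sup>2 \<le> \<Lambda> / \<Lambda>\<^sup>2"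
      by (intro divide_right_mono) auto
    also have "\<dots> = (1 / real l) ^ p"
      using \<Lambda>_pos by (simp add: power2_eq_square power_divide)
    also have "\<dots> \<le> (9 / sqrt (real l)) ^ p"
    proof (intro power_mono frac_le)
      have "sqrt (real l) * 1 \<le> sqrt (real l) * sqrt (real l)"
        using l by (intro mult_left_mono) auto
      then show "sqrt (real l) \<le> real l" by simp
    qed (use l in auto)
    finally show ?thesis .
  qed
  also have "(9 / sqrt (real l)) ^ p + (9 / sqrt (real l)) ^ p \<le> 2 ^ p * (9 / sqrt (real l)) ^ p"
    using p power_increasing[of 1 p "2::real"] mult_right_mono[of 2 "2 ^ p" "(9 / sqrt (real l)) ^ p"] by simp
  also have "\<dots> = (18 / sqrt (real l)) ^ p"
    by (simp flip: power_mult_distrib)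
  finally show ?thesis by simp
qed

text \<open>
Cauchy-Schwarz, in the form \<open>v \<le> \<tau> / 2 + v\<^sup>2 / (2 \<tau>)\<close> under the integral.
\<close>

lemma integral_norm_avg_le:
  assumes "\<tau> > 0" "(18 / sqrt (real l)) ^ p \<le> \<tau>\<^sup>2"
  shows "integral {0..1} (\<lambda>y. norm (avg y)) \<le> \<tau>"
proof -
  have "norm (avg y) \<le> \<tau> / 2 + (norm (avg y))\<^sup>2 / (2 * \<tau>)" for y
  proof -
    have "0 \<le> (norm (avg y) - \<tau>)\<^sup>2" by simp
    then have "norm (avg y) * (2 * \<tau>) \<le> \<tau> * \<tau> + (norm (avg y))\<^sup>2"
      by (simp add: power2_eq_square algebra_simps)
    then show ?thesis using assms(1) by (simp add: field_simps)
  qed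
  then have "integral {0..1} (\<lambda>y. norm (avg y)) \<le> integral {0..1} (\<lambda>y. \<tau> / 2 + (norm (avg y))\<^sup>2 / (2 * \<tau>))"
    using assms(1) by (intro integral_le integrable_continuous_interval continuous_intros continuous_on_avg) auto
  also have "\<dots> = \<tau> / 2 + integral {0..1} (\<lambda>y. (norm (avg y))\<^sup>2) / (2 * \<tau>)"
    by (subst integral_add)
      (auto intro!: integrable_continuous_interval continuous_intros continuous_on_avg simp: assms(1) less_imp_neq[symmetric])
  also have "\<dots> \<le> \<tau> / 2 + \<tau>\<^sup>2 / (2 * \<tau>)"
    using assms integral_avg_square_le by (intro add_left_mono divide_right_mono) auto
  also have "\<dots> = \<tau>"
    using assms by (simp add: power2_eq_square)
  finally show ?thesis .
qed

definition avg' :: "real \<Rightarrow> complex" where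
  "avg' y = (\<Sum>k<l ^ p. a (branch k y) * (\<i> * of_real (branch_phase' k y) * cis (branch_phase k y)) + a' (branch k y) / of_real \<Lambda> * cis (branch_phase k y)) /\<^sub>R \<Lambda>"

lemma avg_deriv: "(avg has_vector_derivative avg' y) (at y)"
  unfolding avg_def[abs_def] avg'_def wave_def
  by (intro bounded_linear.has_vector_derivative[OF bounded_linear_scaleR_right] has_vector_derivative_sum
      has_vector_derivative_mult amp_deriv cis_has_vector_derivative branch_phase_deriv)

lemma norm_avg'_le:
  assumes y: "y \<in> {0..1}"
  shows "norm (avg' y) \<le> 10 * T"
proof -
  have "norm (a (branch k y) * (\<i> * of_real (branch_phase' k y) * cis (branch_phase k y)) + a' (branch k y) / of_real \<Lambda> * cis (branch_phase k y)) \<le> 10 * T"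
    if k: "k < l ^ p" for k
  proof -
    have "norm (a' (branch k y)) \<le> \<Lambda>"
      using a'_le[OF branch_in[OF k y]] \<Lambda>_ge l by linarith
    then have "norm (a' (branch k y)) / \<Lambda> \<le> 1"
      using \<Lambda>_pos by simp
    then have "norm (a' (branch k y) / of_real \<Lambda> * cis (branch_phase k y)) \<le> T"
      using T_ge_1 by (simp add: norm_mult norm_divide norm_power)
    moreover have "norm (a (branch k y) * (\<i> * of_real (branch_phase' k y) * cis (branch_phase k y))) \<le> 1 * (9 * T)"
      unfolding norm_mult[of "a _"] using a_le[OF branch_in[OF k y]] branch_phase'_le[OF k y]
      by (intro mult_mono) (auto simp: norm_mult)
    ultimately show ?thesis
      by (intro norm_triangle_le) simp
  qed
  then have "norm (\<Sum>k<l ^ p. a (branch k y) * (\<i> * of_real (branch_phase' k y) * cis (branch_phase k y)) + a' (branch k y) / of_real \<Lambda> * cis (branch_phase k y))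
      \<le> (\<Sum>k<l ^ p. 10 * T)"
    by (intro sum_norm_le) auto
  then show ?thesis
    unfolding avg'_def using \<Lambda>_pos by (simp add: norm_power field_simps)
qed

lemma avg_cell_deriv:
  "((\<lambda>z. avg (cell l r q z)) has_vector_derivative (1 / real l ^ r) *\<^sub>R avg' (cell l r q z)) (at z)"
proof -
  have "(cell l r q has_vector_derivative 1 / real l ^ r) (at z)"
    using cell_deriv[of l r q z] l has_real_derivative_iff_has_vector_derivative by force
  from vector_diff_chain_at[OF this avg_deriv] show ?thesis
    by (simp add: o_def)
qed

lemma norm_avg_cell_deriv_le:
  assumes "q < l ^ r" "z \<in> {0..1}"
  shows "norm ((1 / real l ^ r) *\<^sub>R avg' (cell l r q z)) \<le> 10 * T / real l ^ r"
  using norm_avg'_le[OF cell_in[OF assms]] l by (simp add: divide_right_mono)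

lemma norm_avg_cell_diff_le:
  assumes "q < l ^ r" "x \<in> {0..1}" "z \<in> {0..1}"
  shows "norm (avg (cell l r q x) - avg (cell l r q z)) \<le> 10 * T / real l ^ r"
  by (rule norm_diff_le_derivative_bound[where f = "\<lambda>z. avg (cell l r q z)", OF avg_cell_deriv])
    (use assms norm_avg_cell_deriv_le in auto)

text \<open>
The phase that the next level has to absorb: the common linear term and the next \<open>r\<close> frequencies. It
does not depend on the branch.
\<close>

definition cell_phase :: "nat \<Rightarrow> real \<Rightarrow> real" where
  "cell_phase r y = M' 0 / \<Lambda> * y + T / 2 ^ p * weier_sum l r y"

lemma branch_integrand_eq:
  "a (branch k y) * cis (M (branch k y) + T * weier l (branch k y)) = wave k y * cis (M' 0 / \<Lambda> * y + T / 2 ^ p * weier l y)"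
proof -
  have "weier l (branch k y) = weier_sum l p (branch k y) + weier l y / 2 ^ p"
    using weier_split[of l "branch k y" p] weier_plus_nat[of l k y] l by (simp add: cell_def)
  then have "M (branch k y) + T * weier l (branch k y) = branch_phase k y + (M' 0 / \<Lambda> * y + T / 2 ^ p * weier l y)"
    by (simp add: branch_phase_def algebra_simps)
  then show ?thesis
    by (simp add: wave_def cis_mult)
qed

lemma integral_eq_avg:
  "integral {0..1} (\<lambda>x. a x * cis (M x + T * weier l x))
    = integral {0..1} (\<lambda>y. avg y * cis (M' 0 / \<Lambda> * y + T / 2 ^ p * weier l y))"
proof -
  have "continuous_on UNIV a"
    by (rule continuous_at_imp_continuous_on) (use a_deriv has_vector_derivative_continuous in blast)
  moreover have "continuous_on UNIV M"
    using M_deriv by (meson DERIV_continuous continuous_at_imp_continuous_on)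
  ultimately have "continuous_on UNIV (\<lambda>x. a x * cis (M x + T * weier l x))"
    by (intro continuous_intros continuous_on_weier)
  from integral_average_over_cells[OF this, of "l ^ p"]
  have "integral {0..1} (\<lambda>x. a x * cis (M x + T * weier l x)) =
     integral {0..1} (\<lambda>y. (\<Sum>k<l ^ p. a (branch k y) * cis (M (branch k y) + T * weier l (branch k y))) /\<^sub>R \<Lambda>)"
    using l by (simp add: cell_def)
  then show ?thesis
    unfolding branch_integrand_eq avg_def by (simp add: sum_distrib_right)
qed

text \<open>
On an interval of length \<open>l\<^sup>-\<^sup>r\<close> the average over the branches varies by at most \<open>10 T / l\<^sup>r\<close>. Adding
this quantity to the value at the left end point gives a normalisation \<open>\<beta>\<close> after which the average
is an admissible amplitude. The frequencies between \<open>l\<^sup>p\<close> and \<open>l\<^sup>p\<^sup>+\<^sup>r\<close> have, after the zoom, second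
derivative at most \<open>T / (2\<^sup>p\<^sup>+\<^sup>r l)\<close>, so they form an admissible slow phase for the amplitude
\<open>T / 2\<^sup>p\<^sup>+\<^sup>r\<close> of the next level.
\<close>

lemma cell_integrand_slowly_modulated:
  fixes q r :: nat and \<beta> :: real
  assumes q: "q < l ^ r" and \<beta>: "\<beta> = norm (avg (cell l r q 0)) + 10 * T / real l ^ r"
  shows "slowly_modulated (T / 2 ^ (p + r) / real l)
    (\<lambda>z. avg (cell l r q z) /\<^sub>R \<beta>) (\<lambda>z. cell_phase r (cell l r q z))"
proof -
  define R where "R = real l ^ r"
  have R: "R > 0" using l by (simp add: R_def)
  define \<delta> where "\<delta> = 10 * T / R"
  have \<delta>: "\<delta> > 0" using T_ge_1 R by (simp add: \<delta>_def)
  define g where "g = cell l r q"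
  have gd: "(g has_real_derivative 1 / R) (at z)" for z
    unfolding g_def R_def using l by (intro cell_deriv) simp
  have ad: "((\<lambda>z. avg (g z)) has_vector_derivative (1 / R) *\<^sub>R avg' (g z)) (at z)" for z
    unfolding g_def R_def by (rule avg_cell_deriv)
  have ad_le: "norm ((1 / R) *\<^sub>R avg' (g z)) \<le> \<delta>" if "z \<in> {0..1}" for z
    unfolding g_def R_def \<delta>_def using q that by (rule norm_avg_cell_deriv_le)
  have \<beta>0: "\<beta> = norm (avg (g 0)) + \<delta>"
    by (simp add: \<beta> g_def R_def \<delta>_def)
  have \<beta>_pos: "\<beta> > 0" and \<delta>_le: "\<delta> \<le> \<beta>"
    using \<delta> by (auto simp: \<beta>0 add_nonneg_pos)
  have b_le: "norm (avg (g z)) \<le> \<beta>" if z: "z \<in> {0..1}" for z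
  proof -
    have "norm (avg (g z) - avg (g 0)) \<le> \<delta>"
      unfolding g_def R_def \<delta>_def using q z by (intro norm_avg_cell_diff_le) auto
    then show ?thesis
      using norm_triangle_ineq2[of "avg (g z)" "avg (g 0)"] by (simp add: \<beta>0)
  qed
  define a1 where "a1 z = inverse \<beta> *\<^sub>R ((1 / R) *\<^sub>R avg' (g z))" for z
  define M1 where "M1 z = (M' 0 / \<Lambda> + T / 2 ^ p * - (2 * pi * weier_slope l r (g z))) * (1 / R)" for z
  define M2 where "M2 z = (T / 2 ^ p * - (2 * pi * (weier_curv l r (g z) * (1 / R)))) * (1 / R)" for z
  have "((\<lambda>z. avg (g z) /\<^sub>R \<beta>) has_vector_derivative a1 z) (at z)" for z
    unfolding a1_def by (intro bounded_linear.has_vector_derivative[OF bounded_linear_scaleR_right] ad)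
  moreover have "((\<lambda>z. cell_phase r (g z)) has_real_derivative M1 z) (at z)" for z
  proof -
    have "(cell_phase r has_real_derivative M' 0 / \<Lambda> + T / 2 ^ p * - (2 * pi * weier_slope l r y)) (at y)" for y
      unfolding cell_phase_def[abs_def]
      by (intro DERIV_add DERIV_cmult_Id DERIV_cmult weier_sum_deriv)
    then show ?thesis
      unfolding M1_def by (rule DERIV_chain2[OF _ gd])
  qed
  moreover have "(M1 has_real_derivative M2 z) (at z)" for z
  proof -
    have "(M1 has_real_derivative (0 + T / 2 ^ p * - (2 * pi * (weier_curv l r (g z) * (1 / R)))) * (1 / R)) (at z)"
      unfolding M1_def[abs_def]
      by (intro DERIV_cmult_right DERIV_add DERIV_cmult DERIV_minus DERIV_const
          DERIV_chain2[OF weier_slope_deriv gd])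
    then show ?thesis by (simp add: M2_def)
  qed
  moreover have "norm (avg (g z) /\<^sub>R \<beta>) \<le> 1" if "z \<in> {0..1}" for z
    using b_le[OF that] \<beta>_pos by (simp add: field_simps)
  moreover have "norm (a1 z) \<le> 1" if "z \<in> {0..1}" for z
  proof -
    have "norm (a1 z) = norm ((1 / R) *\<^sub>R avg' (g z)) / \<beta>"
      unfolding a1_def norm_scaleR[of "inverse \<beta>"] using \<beta>_pos by (simp add: divide_inverse)
    also have "\<dots> \<le> 1"
      using order_trans[OF ad_le[OF that] \<delta>_le] \<beta>_pos by (intro divide_le_eq_1_pos[THEN iffD2])
    finally show ?thesis .
  qed
  moreover have "\<bar>M2 z\<bar> \<le> T / 2 ^ (p + r) / real l" for z
  proof -
    have "\<bar>M2 z\<bar> = T / 2 ^ p * (2 * pi * (\<bar>weier_curv l r (g z)\<bar> / R\<^sup>2))"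
      unfolding M2_def using T_ge_1 R by (simp add: abs_mult power2_eq_square)
    also have "\<dots> \<le> T / 2 ^ p * (2 * 4 * (R\<^sup>2 / (10 * real l * 2 ^ r) / R\<^sup>2))"
      using T_ge_1 pi_less_4 abs_weier_curv_le[OF l, of r "g z"] unfolding R_def
      by (intro mult_left_mono mult_mono divide_right_mono) auto
    also have "\<dots> = 8 / 10 * (T / 2 ^ (p + r) / real l)"
      using R by (simp add: power_add mult_ac)
    also have "\<dots> \<le> T / 2 ^ (p + r) / real l"
      using T_ge_1 by (intro mult_left_le_one_le) auto
    finally show ?thesis .
  qed
  ultimately show ?thesis
    unfolding slowly_modulated_def g_def by blast
qed

text \<open>
After the folding, the integral is cut into cells of length \<open>l\<^sup>-\<^sup>r\<close>. On each cell one sees the same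
kind of integral with \<open>T / 2\<^sup>p\<^sup>+\<^sup>r\<close> in place of \<open>T\<close>, multiplied by the size \<open>\<beta> q\<close> of the average on that
cell; the mean of the sizes \<open>\<beta> q\<close> is bounded by the mean modulus of the average, up to its oscillation. That
the error terms appear as factors in front of \<open>B\<close>, instead of being added to it, is what allows the
step to be iterated.
\<close>

lemma osc_integral_step:
  assumes B: "osc_bound l (T / 2 ^ (p + r)) B"
    and \<tau>: "\<tau> > 0" "(18 / sqrt (real l)) ^ p \<le> \<tau>\<^sup>2"
  shows "norm (integral {0..1} (\<lambda>x. a x * cis (M x + T * weier l x))) \<le> (\<tau> + 20 * T / real l ^ r) * B"
proof -
  define R where "R = real l ^ r"
  have R: "R > 0" using l by (simp add: R_def)
  define \<delta> where "\<delta> = 10 * T / R"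
  have \<delta>: "\<delta> > 0" using T_ge_1 R by (simp add: \<delta>_def)
  define g where "g = cell l r"
  define \<beta> where "\<beta> q = norm (avg (g q 0)) + \<delta>" for q
  have \<beta>: "\<beta> q > 0" for q
    using \<delta> by (simp add: \<beta>_def add_nonneg_pos)
  have g_cont: "continuous_on S (g q)" for S q
    unfolding g_def using l by (intro continuous_on_cell) simp
  have avg_g_cont: "continuous_on S (\<lambda>z. avg (g q z))" for S q
    by (rule continuous_on_compose2[OF continuous_on_avg[of UNIV] g_cont]) auto
  define J where "J q = integral {0..1} (\<lambda>z. avg (g q z) * cis (cell_phase r (g q z) + T / 2 ^ (p + r) * weier l z))" for q
  have phase_cont: "continuous_on S (\<lambda>z. cell_phase r (g q z))" for S q
    unfolding cell_phase_def weier_sum_def by (intro continuous_intros g_cont) auto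
  have cell: "(\<lambda>z. avg (g q z) * cis (cell_phase r (g q z) + T / 2 ^ (p + r) * weier l z)) integrable_on {0..1}" for q
    by (intro integrable_continuous_interval continuous_intros avg_g_cont phase_cont continuous_on_weier)
  have arg: "M' 0 / \<Lambda> * g q z + T / 2 ^ p * weier l (g q z) = cell_phase r (g q z) + T / 2 ^ (p + r) * weier l z" for q z
  proof -
    have "weier l (g q z) = weier_sum l r (g q z) + weier l z / 2 ^ r"
      using weier_split[of l "g q z" r] weier_plus_nat[of l q z] l by (simp add: g_def cell_def)
    then show ?thesis
      by (simp add: cell_phase_def power_add algebra_simps)
  qed
  have "continuous_on UNIV (\<lambda>y. avg y * cis (M' 0 / \<Lambda> * y + T / 2 ^ p * weier l y))"
    by (intro continuous_intros continuous_on_avg continuous_on_weier)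
  from integral_average_over_cells[OF this, of "l ^ r"]
  have "integral {0..1} (\<lambda>x. a x * cis (M x + T * weier l x)) =
      integral {0..1} (\<lambda>z. (\<Sum>q<l ^ r. avg (g q z) * cis (M' 0 / \<Lambda> * g q z + T / 2 ^ p * weier l (g q z))) /\<^sub>R R)"
    using l unfolding integral_eq_avg by (simp add: g_def cell_def R_def)
  also have "\<dots> = integral {0..1} (\<lambda>z. (\<Sum>q<l ^ r. avg (g q z) * cis (cell_phase r (g q z) + T / 2 ^ (p + r) * weier l z)) /\<^sub>R R)"
    by (simp only: arg)
  also have "\<dots> = (\<Sum>q<l ^ r. J q) /\<^sub>R R"
    unfolding J_def by (simp only: integral_cmul integral_sum[OF finite_lessThan cell])
  finally have eq: "integral {0..1} (\<lambda>x. a x * cis (M x + T * weier l x)) = (\<Sum>q<l ^ r. J q) /\<^sub>R R" .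
  have J: "norm (J q) \<le> \<beta> q * B" if q: "q < l ^ r" for q
  proof -
    have "slowly_modulated (T / 2 ^ (p + r) / real l) (\<lambda>z. avg (g q z) /\<^sub>R \<beta> q) (\<lambda>z. cell_phase r (g q z))"
      unfolding g_def using q by (rule cell_integrand_slowly_modulated) (simp add: \<beta>_def \<delta>_def g_def R_def)
    then have "norm (integral {0..1} (\<lambda>z. avg (g q z) /\<^sub>R \<beta> q * cis (cell_phase r (g q z) + T / 2 ^ (p + r) * weier l z))) \<le> B"
      using B unfolding osc_bound_def by blast
    then have "norm (J q) / \<beta> q \<le> B"
      using \<beta>[of q] by (simp add: J_def divide_inverse mult.commute)
    then show ?thesis
      using \<beta>[of q] by (simp add: field_simps)
  qed
  have B0: "0 \<le> B"
  proof -
    have "0 \<le> \<beta> 0 * B"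
      using order_trans[OF norm_ge_zero J[of 0]] l by simp
    then show ?thesis using \<beta>[of 0] by (simp add: zero_le_mult_iff)
  qed
  have \<beta>_le: "\<beta> q \<le> integral {0..1} (\<lambda>z. norm (avg (g q z))) + 2 * \<delta>" if q: "q < l ^ r" for q
  proof -
    have "norm (avg (g q 0)) - \<delta> \<le> norm (avg (g q z))" if z: "z \<in> {0..1}" for z
    proof -
      have "norm (avg (g q 0) - avg (g q z)) \<le> \<delta>"
        unfolding g_def R_def \<delta>_def using q z by (intro norm_avg_cell_diff_le) auto
      then show ?thesis
        using norm_triangle_ineq2[of "avg (g q 0)" "avg (g q z)"] by simp
    qed
    then have "integral {0..1} (\<lambda>z::real. norm (avg (g q 0)) - \<delta>) \<le> integral {0..1} (\<lambda>z. norm (avg (g q z)))"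
      by (intro integral_le integrable_continuous_interval continuous_intros avg_g_cont) auto
    then show ?thesis by (simp add: \<beta>_def)
  qed
  have "norm (integral {0..1} (\<lambda>x. a x * cis (M x + T * weier l x))) = norm (\<Sum>q<l ^ r. J q) / R"
    unfolding eq using R by (simp add: divide_inverse mult.commute)
  also have "\<dots> \<le> (\<Sum>q<l ^ r. \<beta> q * B) / R"
    using R J by (intro divide_right_mono sum_norm_le) auto
  also have "\<dots> \<le> (\<Sum>q<l ^ r. (integral {0..1} (\<lambda>z. norm (avg (g q z))) + 2 * \<delta>) * B) / R"
    using R B0 \<beta>_le by (intro divide_right_mono sum_mono mult_right_mono) auto
  also have "\<dots> = ((\<Sum>q<l ^ r. integral {0..1} (\<lambda>z. norm (avg (g q z)))) / R + 2 * \<delta>) * B"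
  proof -
    have "(\<Sum>q<l ^ r. (integral {0..1} (\<lambda>z. norm (avg (g q z))) + 2 * \<delta>) * B)
        = ((\<Sum>q<l ^ r. integral {0..1} (\<lambda>z. norm (avg (g q z)))) + R * (2 * \<delta>)) * B"
      by (simp add: sum.distrib R_def flip: sum_distrib_right)
    then show ?thesis
      using R by (simp add: add_divide_distrib distrib_right)
  qed
  also have "(\<Sum>q<l ^ r. integral {0..1} (\<lambda>z. norm (avg (g q z)))) / R = integral {0..1} (\<lambda>y. norm (avg y))"
  proof -
    have "continuous_on UNIV (\<lambda>y. norm (avg y))"
      by (intro continuous_intros continuous_on_avg)
    from integral_average_over_cells[OF this, of "l ^ r"] show ?thesis
      using l by (simp add: g_def cell_def R_def divide_inverse mult.commute integral_sum
          integrable_continuous_interval continuous_on_norm avg_g_cont[unfolded g_def cell_def R_def divide_inverse])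
  qed
  also have "(integral {0..1} (\<lambda>y. norm (avg y)) + 2 * \<delta>) * B \<le> (\<tau> + 2 * \<delta>) * B"
    using integral_norm_avg_le[OF \<tau>] B0 by (intro mult_right_mono) auto
  finally show ?thesis
    by (simp add: \<delta>_def R_def)
qed

end

section \<open>Power decay by renormalisation\<close>

lemma osc_bound_one: "osc_bound l T 1"
  unfolding osc_bound_def
proof (intro allI impI)
  fix a M assume "slowly_modulated (T / real l) a M"
  then obtain a' M' where a: "\<And>x. (a has_vector_derivative a' x) (at x)"
    and M: "\<And>x. (M has_real_derivative M' x) (at x)"
    and le: "\<And>x. x \<in> {0..1} \<Longrightarrow> norm (a x) \<le> 1"
    unfolding slowly_modulated_def by metis
  have "continuous_on {0..1} a"
    by (rule continuous_at_imp_continuous_on) (use a has_vector_derivative_continuous in blast)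
  moreover have "continuous_on {0..1} M"
    using M by (meson DERIV_continuous continuous_at_imp_continuous_on)
  ultimately have "(\<lambda>x. a x * cis (M x + T * weier l x)) integrable_on {0..1}"
    by (intro integrable_continuous_interval continuous_intros continuous_on_weier)
  then have "norm (integral {0..1} (\<lambda>x. a x * cis (M x + T * weier l x))) \<le> integral {0..1} (\<lambda>x::real. 1)"
    using le by (intro integral_norm_bound_integral) (auto simp: norm_mult)
  then show "norm (integral {0..1} (\<lambda>x. a x * cis (M x + T * weier l x))) \<le> 1"
    by simp
qed

lemma osc_bound_step:
  assumes "l \<ge> 200" "p \<ge> 1" "real l ^ (8 * p) \<le> T" "osc_bound l (T / 2 ^ (p + r)) B"
    and "\<tau> > 0" "(18 / sqrt (real l)) ^ p \<le> \<tau>\<^sup>2"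
  shows "osc_bound l T ((\<tau> + 20 * T / real l ^ r) * B)"
  unfolding osc_bound_def
proof (intro allI impI)
  fix a M assume "slowly_modulated (T / real l) a M"
  then obtain a' M' M'' where "\<And>x. (a has_vector_derivative a' x) (at x)"
    "\<And>x. (M has_real_derivative M' x) (at x)" "\<And>x. (M' has_real_derivative M'' x) (at x)"
    "\<And>x. x \<in> {0..1} \<Longrightarrow> norm (a x) \<le> 1 \<and> norm (a' x) \<le> 1 \<and> \<bar>M'' x\<bar> \<le> T / real l"
    unfolding slowly_modulated_def by metis
  then interpret slow_modulation l p T a a' M M' M''
    using assms by unfold_locales blast+
  show "norm (integral {0..1} (\<lambda>x. a x * cis (M x + T * weier l x))) \<le> (\<tau> + 20 * T / real l ^ r) * B"
    using assms by (intro osc_integral_step)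
qed

lemma osc_bound_mono: "osc_bound l T B \<Longrightarrow> B \<le> B' \<Longrightarrow> osc_bound l T B'"
  unfolding osc_bound_def by (meson order_trans)

lemma osc_bound_nonneg:
  assumes "osc_bound l T B" "T \<ge> 0"
  shows "B \<ge> 0"
proof -
  have "slowly_modulated (T / real l) (\<lambda>_. 0) (\<lambda>_. 0)"
    unfolding slowly_modulated_def
    by (intro exI[of _ "\<lambda>_. 0"] conjI allI ballI) (auto intro: derivative_eq_intros simp: assms)
  then show ?thesis
    using assms unfolding osc_bound_def by (meson norm_ge_zero order_trans)
qed

text \<open>
The step with \<open>r = 9 p + 8\<close>, chosen so that \<open>l\<^sup>r\<close> exceeds the upper bound for \<open>T\<close> by a factor \<open>l\<^sup>p\<close>.
The gain is a negative power of \<open>l\<close> with exponent proportional to \<open>p\<close>. The number \<open>10 p + 8 \<le> 18 p\<close> of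
scales that are used up is proportional to \<open>p\<close> as well. Hence, as soon as \<open>l\<close> is large in terms of
\<open>N\<close>, the gain is at least a factor \<open>2\<^sup>-\<^sup>N\<close> for each scale.
\<close>

lemma block_gain:
  fixes l N p :: nat and T :: real
  assumes l: "2 ^ (72 * N + 16) \<le> l" and p: "p \<ge> 1"
    and T: "real l ^ (8 * p) \<le> T" "T < real l ^ (8 * (p + 1))"
    and B: "osc_bound l (T / 2 ^ (10 * p + 8)) B"
  shows "osc_bound l T (B / 2 ^ (N * (10 * p + 8)))"
proof -
  define L where "L = 10 * p + 8"
  \<comment> \<open>half of the required gain; the other half pays for the variation inside the cells\<close>
  define \<tau> :: real where "\<tau> = 1 / 2 ^ (N * L + 1)"
  have L: "L \<le> 18 * p"
    using p by (simp add: L_def)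
  have l200: "l \<ge> 200"
  proof -
    have "(2::nat) ^ 16 \<le> 2 ^ (72 * N + 16)"
      by (intro power_increasing) auto
    then show ?thesis using l by simp
  qed
  have lr: "(2::real) ^ (72 * N + 16) \<le> real l"
    using l by (metis of_nat_le_iff of_nat_numeral of_nat_power)
  \<comment> \<open>since \<open>2 * L \<le> 36 * p\<close>, the condition on \<open>\<tau>\<close> holds once \<open>sqrt l \<ge> 18 * 2 ^ (36 * N + 2)\<close>\<close>
  have "(2::real) ^ (36 * N + 8) = sqrt (2 ^ (72 * N + 16))"
  proof (rule real_sqrt_unique[symmetric])
    show "((2::real) ^ (36 * N + 8))\<^sup>2 = 2 ^ (72 * N + 16)"
      by (simp flip: power_mult)
  qed simp
  also have "\<dots> \<le> sqrt (real l)"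
    using lr by (rule real_sqrt_le_mono)
  finally have sq: "(2::real) ^ (36 * N + 8) \<le> sqrt (real l)" .
  have \<tau>: "\<tau> > 0" "(18 / sqrt (real l)) ^ p \<le> \<tau>\<^sup>2"
  proof -
    show "\<tau> > 0" by (simp add: \<tau>_def)
    have "18 / sqrt (real l) \<le> 18 / 2 ^ (36 * N + 8)"
      using sq l200 by (intro divide_left_mono) auto
    also have "\<dots> \<le> 1 / 2 ^ (36 * N + 2)"
      by (simp add: power_add field_simps)
    finally have "(18 / sqrt (real l)) ^ p \<le> (1 / 2 ^ (36 * N + 2)) ^ p"
      by (intro power_mono) auto
    also have "\<dots> = 1 / 2 ^ ((36 * N + 2) * p)"
      by (simp only: power_divide power_one power_mult)
    also have "\<dots> \<le> 1 / 2 ^ (2 * (N * L + 1))"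
    proof (intro divide_left_mono power_increasing)
      have "2 * (N * L + 1) \<le> 2 * (N * (18 * p) + p)"
        using L p by (intro mult_left_mono add_mono) auto
      then show "2 * (N * L + 1) \<le> (36 * N + 2) * p"
        by (simp add: algebra_simps)
    qed auto
    also have "\<dots> = \<tau>\<^sup>2"
      unfolding \<tau>_def by (simp add: power_divide mult.commute flip: power_mult)
    finally show "(18 / sqrt (real l)) ^ p \<le> \<tau>\<^sup>2" .
  qed
  have "20 * T / real l ^ (9 * p + 8) \<le> \<tau>"
  proof -
    have "20 * T / real l ^ (9 * p + 8) \<le> 20 * real l ^ (8 * (p + 1)) / real l ^ (9 * p + 8)"
      using T l200 by (intro divide_right_mono mult_left_mono) auto
    also have "\<dots> = 20 * (real l ^ (8 * p + 8) / (real l ^ (8 * p + 8) * real l ^ p))"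
      by (simp add: add.commute flip: power_add)
    also have "\<dots> = 20 / real l ^ p"
      using l200 by simp
    also have "\<dots> \<le> 20 / (2 ^ (72 * N + 16)) ^ p"
      using lr l200 by (intro divide_left_mono power_mono) auto
    also have "\<dots> \<le> 1 / 2 ^ (N * L + 1)"
    proof -
      have "(20::real) * 2 ^ (N * L + 1) \<le> 2 ^ 5 * 2 ^ (N * L + 1)"
        by simp
      also have "\<dots> = 2 ^ (5 + (N * L + 1))"
        by (simp add: power_add)
      also have "\<dots> \<le> 2 ^ ((72 * N + 16) * p)"
      proof (intro power_increasing)
        have "N * L \<le> N * (18 * p)"
          using L by (rule mult_left_mono) simp
        moreover have "N * (18 * p) = 18 * (N * p)" "(72 * N + 16) * p = 72 * (N * p) + 16 * p"
          by (simp_all add: algebra_simps)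
        ultimately show "5 + (N * L + 1) \<le> (72 * N + 16) * p"
          using p by linarith
      qed simp
      finally show ?thesis
        by (simp add: field_simps flip: power_mult)
    qed
    finally show ?thesis by (simp add: \<tau>_def)
  qed
  then have "\<tau> + 20 * T / real l ^ (9 * p + 8) \<le> 1 / 2 ^ (N * L)"
    by (simp add: \<tau>_def)
  moreover have "T \<ge> 0"
    using T(1) by (meson of_nat_0_le_iff order_trans zero_le_power)
  then have "B \<ge> 0"
    using osc_bound_nonneg[OF B] by simp
  ultimately have "(\<tau> + 20 * T / real l ^ (9 * p + 8)) * B \<le> 1 / 2 ^ (N * L) * B"
    by (rule mult_right_mono)
  moreover have "osc_bound l T ((\<tau> + 20 * T / real l ^ (9 * p + 8)) * B)"
  proof (rule osc_bound_step[OF l200 p T(1) _ \<tau>])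
    have "p + (9 * p + 8) = 10 * p + 8" by simp
    then show "osc_bound l (T / 2 ^ (p + (9 * p + 8))) B" using B by metis
  qed
  ultimately show ?thesis
    unfolding L_def using osc_bound_mono by fastforce
qed

text \<open>
Using \<open>L\<close> scales divides \<open>T\<close> by \<open>2\<^sup>L\<close> and the bound by \<open>2\<^sup>N\<^sup>L\<close>, so the power \<open>T\<^sup>-\<^sup>N\<close> reproduces itself.
The iteration stops when \<open>T \<le> l ^ 8\<close>, where the trivial bound 1 suffices.
\<close>

lemma osc_bound_power_decay:
  fixes l N :: nat and T :: real
  assumes l: "2 ^ (72 * N + 16) \<le> l" and T: "T > 0"
  shows "osc_bound l T ((real l ^ 8 / T) ^ N)"
proof -
  have "(2::nat) ^ 16 \<le> 2 ^ (72 * N + 16)"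
    by (intro power_increasing) auto
  then have l1: "l \<ge> 2" using l by simp
  have "osc_bound l T ((real l ^ 8 / T) ^ N)" if "T > 0" "T \<le> real l ^ 8 * 2 ^ n" for n T
    using that
  proof (induction n arbitrary: T)
    case 0
    then have "1 \<le> (real l ^ 8 / T) ^ N"
      by (intro one_le_power) simp
    then show ?case
      using osc_bound_mono osc_bound_one by blast
  next
    case (Suc n)
    show ?case
    proof (cases "T < real l ^ 8")
      case True
      then have "1 \<le> (real l ^ 8 / T) ^ N"
        using Suc.prems by (intro one_le_power) simp
      then show ?thesis
        using osc_bound_mono osc_bound_one by blast
    next
      case False
      obtain m where "T < (real l ^ 8) ^ m"
        using real_arch_pow[of "real l ^ 8" T] one_less_power[of "real l" 8] l1 by auto
      then have ex: "\<exists>m. T < (real l ^ 8) ^ m" by blast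
      define m where "m = (LEAST m. T < (real l ^ 8) ^ m)"
      have m: "T < (real l ^ 8) ^ m"
        unfolding m_def using ex by (rule LeastI_ex)
      have "1 \<le> T"
        using False one_le_power[of "real l" 8] l1 by linarith
      then have "m \<noteq> 0" "m \<noteq> 1"
        using m False by (metis not_less power_0, metis power_one_right)
      then obtain p where p: "m = Suc p" "p \<ge> 1"
        by (cases m) auto
      have "\<not> T < (real l ^ 8) ^ p"
        using not_less_Least[of p "\<lambda>m. T < (real l ^ 8) ^ m"] p by (simp add: m_def)
      then have p1: "real l ^ (8 * p) \<le> T"
        by (simp add: power_mult)
      have p2: "T < real l ^ (8 * (p + 1))"
        using m unfolding p(1) by (metis Suc_eq_plus1 power_mult)
      define L where "L = 10 * p + 8"
      have "(2::real) ^ 1 \<le> 2 ^ L"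
        by (intro power_increasing) (auto simp: L_def)
      then have "T / 2 ^ L \<le> T / 2"
        using Suc.prems by (intro divide_left_mono) auto
      also have "\<dots> \<le> real l ^ 8 * 2 ^ n"
        using Suc.prems by simp
      finally have "osc_bound l (T / 2 ^ L) ((real l ^ 8 / (T / 2 ^ L)) ^ N)"
        using Suc.prems by (intro Suc.IH) auto
      then have "osc_bound l T ((real l ^ 8 / (T / 2 ^ L)) ^ N / 2 ^ (N * L))"
        unfolding L_def by (rule block_gain[OF l p(2) p1 p2])
      also have "(real l ^ 8 / (T / 2 ^ L)) ^ N / 2 ^ (N * L) = (real l ^ 8 / T) ^ N"
        by (simp add: power_divide power_mult_distrib mult.commute flip: power_mult)
      finally show ?thesis .
    qed
  qed
  moreover obtain n where "T / real l ^ 8 < 2 ^ n"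
    using real_arch_pow[of 2 "T / real l ^ 8"] by auto
  then have "T \<le> real l ^ 8 * 2 ^ n"
    using l1 by (simp add: field_simps)
  ultimately show ?thesis
    using T by blast
qed

section \<open>Matrix entries of the propagator\<close>

lemma sums_integral_of_dominated:
  fixes f :: "nat \<Rightarrow> real \<Rightarrow> complex"
  assumes "\<And>j. continuous_on {0..1} (f j)"
    and "\<And>j x. x \<in> {0..1} \<Longrightarrow> norm (f j x) \<le> K j" and "summable K"
  shows "(\<lambda>j. integral {0..1} (f j)) sums integral {0..1} (\<lambda>x. \<Sum>j. f j x)"
proof -
  have "uniform_limit {0..1} (\<lambda>n x. \<Sum>j<n. f j x) (\<lambda>x. \<Sum>j. f j x) sequentially"
    using assms(2,3) by (rule Weierstrass_m_test)
  then obtain I J where I: "\<And>n. ((\<lambda>x. \<Sum>j<n. f j x) has_integral I n) {0..1}"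
    and J: "((\<lambda>x. \<Sum>j. f j x) has_integral J) {0..1}" and lim: "I \<longlonglongrightarrow> J"
    by (rule uniform_limit_integral) (auto intro!: continuous_on_sum assms)
  have "I n = (\<Sum>j<n. integral {0..1} (f j))" for n
  proof -
    have "integral {0..1} (\<lambda>x. \<Sum>j<n. f j x) = (\<Sum>j<n. integral {0..1} (f j))"
      by (intro integral_sum integrable_continuous_interval assms) auto
    then show ?thesis
      using integral_unique[OF I] by simp
  qed
  then have "I = (\<lambda>n. \<Sum>j<n. integral {0..1} (f j))"
    by (rule ext)
  then show ?thesis
    using lim J unfolding sums_def by (simp add: integral_unique)
qed

lemma integral_character:
  fixes k :: int
  shows "integral {0..1} (\<lambda>x. cis (2 * pi * of_int k * x)) = (if k = 0 then 1 else 0)"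
proof (cases "k = 0")
  case False
  define c :: complex where "c = \<i> * of_real (2 * pi * of_int k)"
  have c: "c \<noteq> 0" using False by (simp add: c_def)
  have "((\<lambda>x. cis (2 * pi * of_int k * x)) has_integral cis (2 * pi * of_int k * 1) / c - cis (2 * pi * of_int k * 0) / c) {0..1}"
  proof (rule fundamental_theorem_of_calculus)
    fix x :: real
    have "((\<lambda>x. cis (2 * pi * of_int k * x)) has_vector_derivative c * cis (2 * pi * of_int k * x)) (at x)"
      unfolding c_def by (intro cis_has_vector_derivative DERIV_cmult_Id)
    then have "((\<lambda>x. cis (2 * pi * of_int k * x) / c) has_vector_derivative c * cis (2 * pi * of_int k * x) / c) (at x)"
      by (rule has_vector_derivative_divide)
    then show "((\<lambda>x. cis (2 * pi * of_int k * x) / c) has_vector_derivative cis (2 * pi * of_int k * x)) (at x within {0..1})"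
      using c has_vector_derivative_at_within by auto
  qed simp
  then have "integral {0..1} (\<lambda>x. cis (2 * pi * of_int k * x)) = (cis (2 * pi * of_int k) - 1) / c"
    by (subst integral_unique) (auto simp: diff_divide_distrib)
  moreover have "cis (2 * pi * of_int k) = 1"
    using cis_multiple_2pi[of "of_int k"] by simp
  ultimately show ?thesis
    using False by simp
qed simp

text \<open>
The weights of the theorem; the symbol of the corresponding operator is
\<open>\<Sum> w k * cis (2 \<pi> k x) = 2 * weier l x\<close>.
\<close>

definition lacunary_weights :: "nat \<Rightarrow> (int \<Rightarrow> real) \<Rightarrow> bool" where
  "lacunary_weights l w \<longleftrightarrow>
     (\<forall>j. w (int l ^ j) = 1 / 2 ^ j \<and> w (- (int l ^ j)) = 1 / 2 ^ j) \<and>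
     (\<forall>k. (\<forall>j. k \<noteq> int l ^ j \<and> k \<noteq> - (int l ^ j)) \<longrightarrow> w k = 0)"

lemma has_sum_lacunary_weights:
  fixes g :: "int \<Rightarrow> 'a :: {real_normed_algebra_1, banach}"
  assumes l: "l \<ge> 2" and w: "lacunary_weights l w" and g: "\<And>k. norm (g k) \<le> C"
  shows "((\<lambda>k. of_real (w k) * g k) has_sum
    (\<Sum>j. of_real (1 / 2 ^ j) * g (int l ^ j)) + (\<Sum>j. of_real (1 / 2 ^ j) * g (- (int l ^ j)))) UNIV"
    and "summable (\<lambda>j. of_real (1 / 2 ^ j) * g (int l ^ j))"
    and "summable (\<lambda>j. of_real (1 / 2 ^ j) * g (- (int l ^ j)))"
proof -
  have w': "w (int l ^ j) = 1 / 2 ^ j" "w (- (int l ^ j)) = 1 / 2 ^ j" for j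
    using w by (auto simp: lacunary_weights_def)
  have sn: "summable (\<lambda>j. norm (of_real (1 / 2 ^ j) * g (h j)))" for h :: "nat \<Rightarrow> int"
  proof (rule summable_comparison_test')
    show "summable (\<lambda>j. 1 / 2 ^ j * C)"
      by (intro summable_mult2 summable_half_power)
    show "norm (norm (of_real (1 / 2 ^ j) * g (h j))) \<le> 1 / 2 ^ j * C" for j
    proof -
      have "norm (of_real (1 / 2 ^ j) * g (h j)) \<le> norm (of_real (1 / 2 ^ j) :: 'a) * norm (g (h j))"
        by (rule norm_mult_ineq)
      also have "\<dots> \<le> 1 / 2 ^ j * C"
        using g by (intro mult_mono) (auto simp only: norm_of_real, auto)
      finally show ?thesis by simp
    qed
  qed
  show s1: "summable (\<lambda>j. of_real (1 / 2 ^ j) * g (int l ^ j))"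
    and s2: "summable (\<lambda>j. of_real (1 / 2 ^ j) * g (- (int l ^ j)))"
    by (rule summable_norm_cancel[OF sn])+
  have inj: "inj (\<lambda>j. int l ^ j)"
    using l by (intro injI) (simp add: power_inject_exp)
  have inj': "inj (\<lambda>j. - (int l ^ j))"
    using inj by (auto simp: inj_def)
  have A: "((\<lambda>k. of_real (w k) * g k) has_sum (\<Sum>j. of_real (1 / 2 ^ j) * g (int l ^ j))) (range (\<lambda>j. int l ^ j))"
    unfolding has_sum_reindex[OF inj] o_def w'
    by (rule norm_summable_imp_has_sum[OF sn summable_sums[OF s1]])
  have B: "((\<lambda>k. of_real (w k) * g k) has_sum (\<Sum>j. of_real (1 / 2 ^ j) * g (- (int l ^ j)))) (range (\<lambda>j. - (int l ^ j)))"
    unfolding has_sum_reindex[OF inj'] o_def w'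
    by (rule norm_summable_imp_has_sum[OF sn summable_sums[OF s2]])
  have "range (\<lambda>j. int l ^ j) \<inter> range (\<lambda>j. - (int l ^ j)) = {}"
  proof -
    have "int l ^ i \<noteq> - (int l ^ j)" for i j
    proof -
      have "0 < int l ^ i" "0 < int l ^ j" using l by auto
      then show ?thesis by linarith
    qed
    then show ?thesis by auto
  qed
  from has_sum_Un_disjoint[OF A B this]
  show "((\<lambda>k. of_real (w k) * g k) has_sum
    (\<Sum>j. of_real (1 / 2 ^ j) * g (int l ^ j)) + (\<Sum>j. of_real (1 / 2 ^ j) * g (- (int l ^ j)))) UNIV"
  proof (rule has_sum_cong_neutral[THEN iffD1, rotated -1])
    fix k assume "k \<in> UNIV - (range (\<lambda>j. int l ^ j) \<union> range (\<lambda>j. - (int l ^ j)))"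
    then have "w k = 0"
      using w unfolding lacunary_weights_def by blast
    then show "of_real (w k) * g k = 0" by simp
  qed auto
qed

text \<open>
In the Fourier representation the operator acts as multiplication by its symbol.
\<close>

lemma coord_H_op_integral:
  assumes l: "l \<ge> 2" and w: "lacunary_weights l w" and F: "continuous_on {0..1} F"
    and u: "\<And>i. coord u i = integral {0..1} (\<lambda>x. F x * cis (2 * pi * of_int (i - m) * x))"
  shows "coord (H_op w u) i =
    integral {0..1} (\<lambda>x. of_real (2 * weier l x) * F x * cis (2 * pi * of_int (i - m) * x))"
proof -
  have w0: "w k \<ge> 0" for k
    using w unfolding lacunary_weights_def by (metis divide_nonneg_nonneg order_refl zero_le_one zero_le_power zero_le_numeral)
  have "(\<lambda>k. w k) summable_on UNIV"
    using has_sum_lacunary_weights(1)[OF l w, of "\<lambda>_. 1 :: real" 1] has_sum_imp_summable by fastforce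
  then have ws: "(\<lambda>k. norm (w k)) summable_on UNIV"
    using w0 by simp
  define g where "g k = coord u (i + k)" for k
  have g: "norm (g k) \<le> norm u" for k
    unfolding g_def by (rule norm_coord_le)
  have ci: "continuous_on {0..1} (\<lambda>x. F x * cis (2 * pi * of_int q * x))" for q :: int
    by (intro continuous_intros F)
  have pair: "of_real (1 / 2 ^ j) * g (int l ^ j) + of_real (1 / 2 ^ j) * g (- (int l ^ j))
      = integral {0..1} (\<lambda>x. of_real (2 * (cos (2 * pi * real l ^ j * x) / 2 ^ j)) * F x * cis (2 * pi * of_int (i - m) * x))" for j
  proof -
    have c: "cis (2 * pi * of_int (i + int l ^ j - m) * x) + cis (2 * pi * of_int (i + - (int l ^ j) - m) * x)
        = of_real (2 * cos (2 * pi * real l ^ j * x)) * cis (2 * pi * of_int (i - m) * x)" for x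
    proof -
      have "2 * pi * of_int (i + int l ^ j - m) * x = 2 * pi * of_int (i - m) * x + 2 * pi * real l ^ j * x"
        "2 * pi * of_int (i + - (int l ^ j) - m) * x = 2 * pi * of_int (i - m) * x - 2 * pi * real l ^ j * x"
        by (simp_all add: algebra_simps)
      then show ?thesis
        by (simp add: complex_eq_iff cos_add cos_diff sin_add sin_diff)
    qed
    have "g (int l ^ j) + g (- (int l ^ j)) = integral {0..1} (\<lambda>x. F x * cis (2 * pi * of_int (i + int l ^ j - m) * x)
        + F x * cis (2 * pi * of_int (i + - (int l ^ j) - m) * x))"
      unfolding g_def u by (rule integral_add[symmetric]) (rule integrable_continuous_interval[OF ci])+
    also have "\<dots> = integral {0..1} (\<lambda>x. F x * (of_real (2 * cos (2 * pi * real l ^ j * x)) * cis (2 * pi * of_int (i - m) * x)))"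
      unfolding distrib_left[symmetric] c ..
    finally have "of_real (1 / 2 ^ j) * (g (int l ^ j) + g (- (int l ^ j))) =
        integral {0..1} (\<lambda>x. of_real (1 / 2 ^ j) * (F x * (of_real (2 * cos (2 * pi * real l ^ j * x)) * cis (2 * pi * of_int (i - m) * x))))"
      by simp
    also have "\<dots> = integral {0..1} (\<lambda>x. of_real (2 * (cos (2 * pi * real l ^ j * x) / 2 ^ j)) * F x * cis (2 * pi * of_int (i - m) * x))"
      by (intro integral_cong) (simp add: mult_ac)
    finally show ?thesis by (simp add: distrib_left)
  qed
  obtain C where C: "\<And>x. x \<in> {0..1} \<Longrightarrow> norm (F x) \<le> C"
  proof -
    have "bounded (F ` {0..1})"
      by (intro compact_imp_bounded compact_continuous_image F) auto
    then obtain b where "\<forall>x\<in>{0..1}. norm (F x) \<le> b"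
      unfolding bounded_iff by auto
    then show ?thesis using that by blast
  qed
  have "coord (H_op w u) i = (\<Sum>\<^sub>\<infinity>k. of_real (w k) * g k)"
    unfolding g_def by (rule H_op_apply[OF ws])
  also have "\<dots> = (\<Sum>j. of_real (1 / 2 ^ j) * g (int l ^ j)) + (\<Sum>j. of_real (1 / 2 ^ j) * g (- (int l ^ j)))"
    by (rule infsumI[OF has_sum_lacunary_weights(1)[OF l w g]])
  also have "\<dots> = (\<Sum>j. of_real (1 / 2 ^ j) * g (int l ^ j) + of_real (1 / 2 ^ j) * g (- (int l ^ j)))"
    by (rule suminf_add[OF has_sum_lacunary_weights(2,3)[OF l w g]])
  also have "\<dots> = (\<Sum>j. integral {0..1} (\<lambda>x. of_real (2 * (cos (2 * pi * real l ^ j * x) / 2 ^ j)) * F x * cis (2 * pi * of_int (i - m) * x)))"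
    unfolding pair ..
  also have "\<dots> = integral {0..1} (\<lambda>x. \<Sum>j. of_real (2 * (cos (2 * pi * real l ^ j * x) / 2 ^ j)) * F x * cis (2 * pi * of_int (i - m) * x))"
  proof (rule sums_unique[symmetric, OF sums_integral_of_dominated])
    show "summable (\<lambda>j. 2 * (1 / 2 ^ j) * C)"
      by (intro summable_mult2 summable_mult summable_half_power)
    fix j and x :: real assume "x \<in> {0..1}"
    then show "norm (of_real (2 * (cos (2 * pi * real l ^ j * x) / 2 ^ j)) * F x * cis (2 * pi * of_int (i - m) * x)) \<le> 2 * (1 / 2 ^ j) * C"
      unfolding norm_mult norm_of_real using C[of x]
      by (simp add: abs_mult) (intro mult_mono divide_right_mono, auto)
  qed (intro continuous_intros F, auto)
  also have "\<dots> = integral {0..1} (\<lambda>x. of_real (2 * weier l x) * F x * cis (2 * pi * of_int (i - m) * x))"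
  proof (rule integral_cong, rule sums_unique[symmetric], intro sums_mult2 sums_of_real sums_mult)
    show "(\<lambda>j. cos (2 * pi * real l ^ j * x) / 2 ^ j) sums weier l x" for x
      unfolding weier_def by (rule summable_sums[OF weier_summable])
  qed
  finally show ?thesis .
qed

lemma op_power_Suc_apply: "op_power A (Suc n) u = A (op_power A n u)"
  unfolding op_power_def by (simp only: funpow.simps o_apply blinfun_apply_blinfun_compose)

lemma coord_op_power:
  assumes l: "l \<ge> 2" and w: "lacunary_weights l w"
  shows "coord (op_power (scaleC_op c (H_op w)) n (delta m)) i =
    integral {0..1} (\<lambda>x. (c * of_real (2 * weier l x)) ^ n * cis (2 * pi * of_int (i - m) * x))"
proof (induction n arbitrary: i)
  case 0
  then show ?case
    using integral_character[of "i - m"] by (simp add: op_power_def delta.rep_eq)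
next
  case (Suc n)
  have "continuous_on {0..1} (\<lambda>x. (c * of_real (2 * weier l x)) ^ n)"
    by (intro continuous_intros continuous_on_weier)
  from coord_H_op_integral[OF l w this Suc]
  have "coord (op_power (scaleC_op c (H_op w)) (Suc n) (delta m)) i =
     c * integral {0..1} (\<lambda>x. of_real (2 * weier l x) * (c * of_real (2 * weier l x)) ^ n * cis (2 * pi * of_int (i - m) * x))"
    by (simp add: op_power_Suc_apply scaleC_op_apply)
  also have "\<dots> = integral {0..1} (\<lambda>x. c * (of_real (2 * weier l x) * (c * of_real (2 * weier l x)) ^ n * cis (2 * pi * of_int (i - m) * x)))"
    by simp
  also have "\<dots> = integral {0..1} (\<lambda>x. (c * of_real (2 * weier l x)) ^ Suc n * cis (2 * pi * of_int (i - m) * x))"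
    by (simp add: mult_ac)
  finally show ?case .
qed

text \<open>
Entries of the exponential are Fourier coefficients of the exponential of the symbol, since the
exponential series converges uniformly on the bounded range of the symbol.
\<close>

lemma coord_op_exp:
  assumes l: "l \<ge> 2" and w: "lacunary_weights l w"
  shows "coord (op_exp (scaleC_op c (H_op w)) (delta m)) i =
    integral {0..1} (\<lambda>x. exp (c * of_real (2 * weier l x)) * cis (2 * pi * of_int (i - m) * x))"
proof -
  let ?A = "scaleC_op c (H_op w)"
  let ?f = "\<lambda>n x. ((c * of_real (2 * weier l x)) ^ n /\<^sub>R fact n) * cis (2 * pi * of_int (i - m) * x)"
  have lin: "bounded_linear (\<lambda>A. coord (blinfun_apply A (delta m)) i)"
    by (rule bounded_linear_compose[OF bounded_linear_coord blinfun.bounded_linear_left])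
  have 1: "(\<lambda>n. coord ((op_power ?A n /\<^sub>R fact n) (delta m)) i) sums coord (op_exp ?A (delta m)) i"
    by (rule bounded_linear.sums[OF lin op_exp_sums])
  have 2: "coord ((op_power ?A n /\<^sub>R fact n) (delta m)) i = integral {0..1} (?f n)" for n
  proof -
    have "coord ((op_power ?A n /\<^sub>R fact n) (delta m)) i
        = integral {0..1} (\<lambda>x. (c * of_real (2 * weier l x)) ^ n * cis (2 * pi * of_int (i - m) * x)) /\<^sub>R fact n"
      by (simp add: scaleR_blinfun.rep_eq coord_op_power[OF l w] scaleR_conv_of_real del: of_real_mult)
    then show ?thesis
      by simp
  qed
  have "(\<lambda>n. integral {0..1} (?f n)) sums integral {0..1} (\<lambda>x. \<Sum>n. ?f n x)"
  proof (rule sums_integral_of_dominated)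
    show "summable (\<lambda>n. (norm c * 4) ^ n /\<^sub>R fact n)"
      by (rule summable_exp_generic)
    show "continuous_on {0..1} (?f n)" for n
      by (intro continuous_intros continuous_on_weier)
    fix n and x :: real
    have "norm (c * of_real (2 * weier l x)) \<le> norm c * 4"
      using abs_weier_le[of l x] unfolding norm_mult norm_of_real by (intro mult_left_mono) auto
    then have "norm ((c * of_real (2 * weier l x)) ^ n) \<le> (norm c * 4) ^ n"
      unfolding norm_power by (intro power_mono) auto
    then show "norm (?f n x) \<le> (norm c * 4) ^ n /\<^sub>R fact n"
      by (simp add: norm_mult mult_left_mono)
  qed
  moreover have "(\<Sum>n. ?f n x) = exp (c * of_real (2 * weier l x)) * cis (2 * pi * of_int (i - m) * x)" for x
    by (rule sums_unique[symmetric]) (intro sums_mult2 exp_converges)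
  ultimately show ?thesis
    using 1 unfolding 2 by (simp add: sums_iff)
qed

text \<open>
The entry is an integral with constant amplitude and linear slow phase. For positive \<open>t\<close> the
integrand has to be conjugated first, because the bounds are stated for a positive multiple of the
Weierstrass function.
\<close>

lemma norm_entry_le:
  assumes l: "l \<ge> 2" and w: "lacunary_weights l w" and B: "osc_bound l (2 * \<bar>t\<bar>) B"
  shows "norm (cinner_ell2 (delta i) (op_exp (scaleC_op (- \<i> * of_real t) (H_op w)) (delta m))) \<le> B"
proof -
  have bound: "norm (integral {0..1} (\<lambda>x. cis (b * x + 2 * \<bar>t\<bar> * weier l x))) \<le> B" for b
  proof -
    have "slowly_modulated (2 * \<bar>t\<bar> / real l) (\<lambda>_. 1) (\<lambda>x. b * x)"
      unfolding slowly_modulated_def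
      by (intro exI[of _ "\<lambda>_. 0"] exI[of _ "\<lambda>_. b"] conjI allI ballI)
        (auto intro: DERIV_cmult_Id)
    then show ?thesis
      using B unfolding osc_bound_def by fastforce
  qed
  define b where "b = 2 * pi * real_of_int (i - m)"
  have e: "exp (- \<i> * of_real t * of_real (2 * weier l x)) * cis (b * x) = cis (b * x - 2 * t * weier l x)" for x
    by (simp add: cis_conv_exp algebra_simps flip: exp_add)
  have entry: "cinner_ell2 (delta i) (op_exp (scaleC_op (- \<i> * of_real t) (H_op w)) (delta m))
      = integral {0..1} (\<lambda>x. cis (b * x - 2 * t * weier l x))"
    unfolding cinner_delta coord_op_exp[OF l w] b_def[symmetric] e ..
  show ?thesis
  proof (cases "t \<le> 0")
    case True
    then show ?thesis using bound[of b] unfolding entry by simp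
  next
    case False
    have "integral {0..1} (\<lambda>x. cis (b * x - 2 * t * weier l x)) = integral {0..1} (\<lambda>x. cnj (cis (- b * x + 2 * \<bar>t\<bar> * weier l x)))"
      using False by (simp add: cis_cnj)
    also have "\<dots> = cnj (integral {0..1} (\<lambda>x. cis (- b * x + 2 * \<bar>t\<bar> * weier l x)))"
      by (rule integral_cnj[symmetric])
    finally show ?thesis using bound[of "- b"] unfolding entry by simp
  qed
qed

theorem theorem1p1:
  "\<forall>N::nat. \<exists>(lam_N::int) (C_N::real). lam_N \<ge> 2 \<and>
     (\<forall>lam::int. lam \<ge> lam_N \<longrightarrow>
       (\<forall>w::int \<Rightarrow> real.
          (\<forall>j::nat. w (lam ^ j) = 1 / 2 ^ j \<and> w (- (lam ^ j)) = 1 / 2 ^ j) \<and>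
          (\<forall>k. (\<forall>j::nat. k \<noteq> lam ^ j \<and> k \<noteq> - (lam ^ j)) \<longrightarrow> w k = 0) \<longrightarrow>
          (\<forall>\<^sub>F t::real in at_infinity.
             norm_l1_linf (op_exp (scaleC_op (- \<i> * of_real t) (H_op w))) \<le> C_N / \<bar>t\<bar> ^ N)))"
proof (intro allI)
  fix N :: nat
  \<comment> \<open>one spare power of \<open>t\<close> absorbs the factor \<open>(l ^ 8) ^ M\<close>, which depends on \<open>l\<close>, into the threshold for \<open>t\<close>\<close>
  define M where "M = Suc N"
  have "(2::int) ^ 1 \<le> 2 ^ (72 * M + 16)"
    by (intro power_increasing) auto
  then have two: "(2::int) ^ (72 * M + 16) \<ge> 2" by simp
  show "\<exists>(lam_N::int) (C_N::real). lam_N \<ge> 2 \<and>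
     (\<forall>lam::int. lam \<ge> lam_N \<longrightarrow>
       (\<forall>w::int \<Rightarrow> real.
          (\<forall>j::nat. w (lam ^ j) = 1 / 2 ^ j \<and> w (- (lam ^ j)) = 1 / 2 ^ j) \<and>
          (\<forall>k. (\<forall>j::nat. k \<noteq> lam ^ j \<and> k \<noteq> - (lam ^ j)) \<longrightarrow> w k = 0) \<longrightarrow>
          (\<forall>\<^sub>F t::real in at_infinity.
             norm_l1_linf (op_exp (scaleC_op (- \<i> * of_real t) (H_op w))) \<le> C_N / \<bar>t\<bar> ^ N)))"
  proof (rule exI[of _ "2 ^ (72 * M + 16)"], rule exI[of _ 1], intro conjI two allI impI)
    fix lam :: int and w :: "int \<Rightarrow> real"
    assume lam: "2 ^ (72 * M + 16) \<le> lam"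
      and w: "(\<forall>j::nat. w (lam ^ j) = 1 / 2 ^ j \<and> w (- (lam ^ j)) = 1 / 2 ^ j) \<and>
          (\<forall>k. (\<forall>j::nat. k \<noteq> lam ^ j \<and> k \<noteq> - (lam ^ j)) \<longrightarrow> w k = 0)"
    define l where "l = nat lam"
    have l_eq: "lam = int l"
      using lam two by (simp add: l_def)
    have l: "2 ^ (72 * M + 16) \<le> l"
      using lam unfolding l_eq by (metis of_nat_le_iff of_nat_numeral of_nat_power)
    have l2: "l \<ge> 2"
      using two lam l_eq by linarith
    have w': "lacunary_weights l w"
      using w unfolding lacunary_weights_def l_eq .
    have "norm_l1_linf (op_exp (scaleC_op (- \<i> * of_real t) (H_op w))) \<le> 1 / \<bar>t\<bar> ^ N"
      if t: "(real l ^ 8) ^ M \<le> norm t" for t :: real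
    proof -
      have "1 \<le> (real l ^ 8) ^ M"
        using l2 by (intro one_le_power) auto
      then have t1: "1 \<le> \<bar>t\<bar>" using t by simp
      have "osc_bound l (2 * \<bar>t\<bar>) ((real l ^ 8 / (2 * \<bar>t\<bar>)) ^ M)"
        using t1 by (intro osc_bound_power_decay[OF l]) auto
      moreover have "(real l ^ 8 / (2 * \<bar>t\<bar>)) ^ M \<le> 1 / \<bar>t\<bar> ^ N"
      proof -
        have "(real l ^ 8 / (2 * \<bar>t\<bar>)) ^ M \<le> (real l ^ 8 / \<bar>t\<bar>) ^ M"
          using t1 by (intro power_mono divide_left_mono) auto
        also have "\<dots> = (real l ^ 8) ^ M / \<bar>t\<bar> ^ M"
          by (simp only: power_divide)
        also have "\<dots> \<le> \<bar>t\<bar> / \<bar>t\<bar> ^ M"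
          using t t1 by (intro divide_right_mono) auto
        also have "\<dots> = 1 / \<bar>t\<bar> ^ N"
          using t1 by (simp add: M_def)
        finally show ?thesis .
      qed
      ultimately have "osc_bound l (2 * \<bar>t\<bar>) (1 / \<bar>t\<bar> ^ N)"
        by (rule osc_bound_mono)
      then show ?thesis
        unfolding norm_l1_linf_def using norm_entry_le[OF l2 w'] by (intro cSUP_least) auto
    qed
    then show "\<forall>\<^sub>F t::real in at_infinity.
             norm_l1_linf (op_exp (scaleC_op (- \<i> * of_real t) (H_op w))) \<le> 1 / \<bar>t\<bar> ^ N"
      unfolding eventually_at_infinity by blast
  qed
qed

end
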